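(* Let $n\ge1$ and $p$ be integers, let $1\le s\le S<\frac p2$ be integers, and let $X_1,\dots,X_n$ be i.i.d. centered Gaussian vectors in $\mathbb{R}^p$ with $\Sigma_n=\frac1n\sum_{k=1}^nX_kX_k^T$. For $u>1$ let $$t_{n,p}^{MS}=S\max\left\{\sqrt{\frac{4u\log(S)}{n(p-S)}},\;\frac{8u\log(S)}{n(p-S)}\right\}$$ and define the test $$\Delta_n^{MS}=I\left(\sum_{i=1}^S\left|\varphi_{A_i}(\Sigma_n-I_p)\right|\ge t_{n,p}^{MS}\right).$$ Then $$R(\Delta_n^{MS},\mathcal{F})\le 4\exp\left(-(u-1)\log(S)\right),\qquad \mathcal{F}=\mathcal{F}(s,S,\sigma),$$ provided that $$\sigma\ge t_{n,p}^{MS}+\max\left\{\sqrt{\frac{4(u-1)(2s+1)\log(S)}{n(p-S)}},\;\frac{8(u-1)(2s+1)\log(S)}{n(p-S)}\right\}.$$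
   Context: $I(\cdot)$ is the indicator function. $\mathbb{P}_\Sigma$ denotes probability when $X_1,\dots,X_n$ are i.i.d. $\mathcal{N}_p(0,\Sigma)$. For a symmetric $p\times p$ matrix $A$, $\varphi_A(B)=\mathrm{Tr}(AB)$. For $1\le j\le p-1$, $A_j$ is the $p\times p$ matrix with entries $[A_j]_{k\ell}=\frac{1}{2(p-j)}$ if $|k-\ell|=j$ and $0$ otherwise. $\mathcal{S}_p^{++}$ is the set of symmetric positive definite $p\times p$ matrices and $\mathcal{T}_p$ the set of $p\times p$ Toeplitz matrices; for $\Sigma\in\mathcal{S}_p^{++}\cap\mathcal{T}_p$ write $\Sigma_{ij}=\sigma_{|i-j|}$. Standing assumption: all covariance matrices satisfy $\sigma_0=1$ (correlation matrices). For a real $\sigma>0$, $\mathcal{F}(s,S,\sigma)$ is the set of $\Sigma\in\mathcal{S}_p^{++}\cap\mathcal{T}_p$ (with $\sigma_0=1$) for which there exists $\mathbf{S}\subseteq\{1,\dots,S\}$ with $|\mathbf{S}|=s$ such that $|\sigma_j|\ge\sigma$ for all $j\in\mathbf{S}$ and $\sigma_j=0$ for all $j\in\{1,\dots,p-1\}\setminus\mathbf{S}$. For a test $\Delta_n$ (a $\{0,1\}$-valued function of the observations) and a class $\mathcal{G}$ of covariance matrices, the maximal testing risk is $R(\Delta_n,\mathcal{G})=\mathbb{P}_{I_p}(\Delta_n=1)+\sup_{\Sigma\in\mathcal{G}}\mathbb{P}_\Sigma(\Delta_n=0)$ (a supremum over an empty class being $0$). *)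

theory Defs
  imports
    "HOL-Probability.Probability"
    "Jordan_Normal_Form.Determinant"
    "Jordan_Normal_Form.Gauss_Jordan_Elimination"
begin

text \<open>
  Matrices and vectors are those of Jordan_Normal_Form, so rows and columns are numbered from
  0 to p - 1; everything below depends on a pair of indices only through their difference.
  A vector used as an outcome is an extensional function on \<open>{..<p}\<close>, so that
  \<open>Pi\<^sub>M {..<p} (\<lambda>_. lborel)\<close> is Lebesgue measure on p-dimensional space.
\<close>

definition mat_trace :: "real mat \<Rightarrow> real" where
  "mat_trace A = (\<Sum>i<dim_row A. A $$ (i, i))"

definition spd_mats :: "nat \<Rightarrow> real mat set" where
  "spd_mats p = {\<Sigma> \<in> carrier_mat p p. transpose_mat \<Sigma> = \<Sigma> \<and>
     (\<forall>v \<in> carrier_vec p. v \<noteq> 0\<^sub>v p \<longrightarrow> 0 < scalar_prod v (\<Sigma> *\<^sub>v v))}"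

definition toeplitz_mats :: "nat \<Rightarrow> real mat set" where
  "toeplitz_mats p = {\<Sigma> \<in> carrier_mat p p.
     \<exists>t :: int \<Rightarrow> real. \<forall>i<p. \<forall>j<p. \<Sigma> $$ (i, j) = t (int i - int j)}"

text \<open>The coefficient \<open>\<sigma>\<^sub>j\<close> of a symmetric Toeplitz matrix, for \<open>j < p\<close>, read off the first row.\<close>

definition toep_coeff :: "real mat \<Rightarrow> nat \<Rightarrow> real" where
  "toep_coeff \<Sigma> j = \<Sigma> $$ (0, j)"

definition sparse_toeplitz_class :: "nat \<Rightarrow> nat \<Rightarrow> nat \<Rightarrow> real \<Rightarrow> real mat set" where
  "sparse_toeplitz_class p s S \<sigma> = {\<Sigma> \<in> spd_mats p \<inter> toeplitz_mats p.
     toep_coeff \<Sigma> 0 = 1 \<and>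
     (\<exists>J \<subseteq> {1..S}. card J = s \<and>
        (\<forall>j \<in> J. \<sigma> \<le> \<bar>toep_coeff \<Sigma> j\<bar>) \<and>
        (\<forall>j \<in> {1..p - 1} - J. toep_coeff \<Sigma> j = 0))}"

text \<open>
  The law \<open>N\<^sub>p(0, \<Sigma>)\<close>, given by its Lebesgue density; meaningful for positive definite \<open>\<Sigma>\<close>,
  for which \<open>mat_inverse\<close> returns the inverse.
\<close>

definition gauss_vec :: "nat \<Rightarrow> real mat \<Rightarrow> (nat \<Rightarrow> real) measure" where
  "gauss_vec p \<Sigma> = density (Pi\<^sub>M {..<p} (\<lambda>_. lborel))
     (\<lambda>x. ennreal (exp (- scalar_prod (vec p x) (the (mat_inverse \<Sigma>) *\<^sub>v vec p x) / 2) /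
                   sqrt ((2 * pi) ^ p * Determinant.det \<Sigma>)))"

text \<open>The joint law of the i.i.d. sample \<open>X\<^sub>1, \<dots>, X\<^sub>n\<close>; \<open>X k i\<close> is the i-th entry of \<open>X\<^sub>k\<close>.\<close>

definition gauss_sample :: "nat \<Rightarrow> nat \<Rightarrow> real mat \<Rightarrow> (nat \<Rightarrow> nat \<Rightarrow> real) measure" where
  "gauss_sample n p \<Sigma> = Pi\<^sub>M {1..n} (\<lambda>_. gauss_vec p \<Sigma>)"

definition sample_cov :: "nat \<Rightarrow> nat \<Rightarrow> (nat \<Rightarrow> nat \<Rightarrow> real) \<Rightarrow> real mat" where
  "sample_cov n p X = mat p p (\<lambda>(i, j). 1 / real n * (\<Sum>k = 1..n. X k i * X k j))"

definition phi :: "real mat \<Rightarrow> real mat \<Rightarrow> real" where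
  "phi A B = mat_trace (A * B)"

definition diag_mat_A :: "nat \<Rightarrow> nat \<Rightarrow> real mat" where
  "diag_mat_A p j = mat p p (\<lambda>(k, l).
     if \<bar>int k - int l\<bar> = int j then 1 / (2 * (real p - real j)) else 0)"

text \<open>
  The maximal testing risk of a \<open>{0, 1}\<close>-valued test. The case distinction is needed because the
  supremum of the empty set of reals is unspecified.
\<close>

definition testing_risk ::
    "nat \<Rightarrow> nat \<Rightarrow> ((nat \<Rightarrow> nat \<Rightarrow> real) \<Rightarrow> nat) \<Rightarrow> real mat set \<Rightarrow> real" where
  "testing_risk n p \<Delta> G =
     measure (gauss_sample n p (1\<^sub>m p)) {X \<in> space (gauss_sample n p (1\<^sub>m p)). \<Delta> X = 1} +
     (if G = {} then 0
      else SUP \<Sigma> \<in> G. measure (gauss_sample n p \<Sigma>) {X \<in> space (gauss_sample n p \<Sigma>). \<Delta> X = 0})"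

definition t_MS :: "nat \<Rightarrow> nat \<Rightarrow> nat \<Rightarrow> real \<Rightarrow> real" where
  "t_MS n p S u = real S *
     max (sqrt (4 * u * ln (real S) / (real n * (real p - real S))))
         (8 * u * ln (real S) / (real n * (real p - real S)))"

definition test_MS :: "nat \<Rightarrow> nat \<Rightarrow> nat \<Rightarrow> real \<Rightarrow> (nat \<Rightarrow> nat \<Rightarrow> real) \<Rightarrow> nat" where
  "test_MS n p S u X =
     (if (\<Sum>i = 1..S. \<bar>phi (diag_mat_A p i) (sample_cov n p X - 1\<^sub>m p)\<bar>) \<ge> t_MS n p S u
      then 1 else 0)"

end

theory Submission
  imports Defs "Jordan_Normal_Form.Schur_Decomposition"
begin

text \<open>
  For a symmetric \<open>A\<close> and \<open>x \<sim> N(0, \<Sigma>)\<close>, the expectation of \<open>exp (x\<^sup>T A x / 2)\<close> is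
  \<open>det (I - A \<Sigma>)\<close> to the power \<open>-1/2\<close>. The eigenvalues of \<open>A \<Sigma>\<close> are real and bounded by its largest absolute
  row sum, and \<open>1 - r \<ge> exp (- r - r\<^sup>2)\<close> for \<open>\<bar>r\<bar> \<le> 1/2\<close>, so this moment is controlled by the traces of
  \<open>A \<Sigma>\<close> and of its square, and Chernoff's method gives exponential tails for \<open>\<phi>\<^sub>A\<close>.

  Under the null hypothesis a union bound over the \<open>2 S\<close> one-sided events suffices. Under an alternative with
  support \<open>J\<close>, acceptance forces the signed average of the \<open>\<phi>\<close> over \<open>J\<close> to fall short of its mean by
  \<open>\<sigma> - t / s\<close>. The row sums of \<open>\<Sigma>\<close> are at most \<open>2 s + 1\<close>. A crude bound on the trace of the square loses a
  factor 2 in the exponent: for \<open>s \<ge> 2\<close> this is repaid by the surplus \<open>t - t / s\<close> of the deviation, and for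
  \<open>s = 1\<close> the loss is avoided by \<open>2 \<sigma>\<^sub>j\<^sup>2 < 1\<close>, which positive definiteness forces on the coordinates \<open>0, j, 2 j\<close>.
\<close>

section \<open>Gaussian integrals of positive definite quadratic forms\<close>

text \<open>Stated for coordinate functions, because the outcomes of \<open>gauss_vec\<close> are
  functions and the form has to be integrated over \<open>Pi\<^sub>M\<close>.\<close>

definition qform :: "nat \<Rightarrow> real mat \<Rightarrow> (nat \<Rightarrow> real) \<Rightarrow> real" where
  "qform p Q x = (\<Sum>i<p. \<Sum>j<p. x i * Q $$ (i, j) * x j)"

lemma scalar_prod_eq_qform:
  assumes "Q \<in> carrier_mat p p"
  shows "scalar_prod (Matrix.vec p x) (Q *\<^sub>v Matrix.vec p x) = qform p Q x"
  using assms
  by (auto simp: scalar_prod_def qform_def lessThan_atLeast0 sum_distrib_left mult.assoc intro!: sum.cong)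

lemma symmetric_mat_index:
  assumes "transpose_mat Q = Q" "Q \<in> carrier_mat p p" "i < p" "j < p"
  shows "Q $$ (i, j) = Q $$ (j, i)"
  by (metis assms carrier_matD index_transpose_mat(1))

text \<open>Positive definiteness in coordinates: a nonzero vector becomes a function with a nonzero
  value below \<open>p\<close>. Later proofs supply their test vectors in this form.\<close>

lemma spd_mats_iff:
  "Q \<in> spd_mats p \<longleftrightarrow> Q \<in> carrier_mat p p \<and> (\<forall>i<p. \<forall>j<p. Q $$ (i, j) = Q $$ (j, i)) \<and>
     (\<forall>x. (\<exists>i<p. x i \<noteq> 0) \<longrightarrow> 0 < qform p Q x)" (is "?L \<longleftrightarrow> ?R")
proof
  assume L: ?L
  hence c: "Q \<in> carrier_mat p p" and t: "transpose_mat Q = Q" by (auto simp: spd_mats_def)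
  have "0 < qform p Q x" if "\<exists>i<p. x i \<noteq> 0" for x
  proof -
    have "Matrix.vec p x \<noteq> 0\<^sub>v p" using that by (metis index_vec index_zero_vec(1))
    hence "0 < scalar_prod (Matrix.vec p x) (Q *\<^sub>v Matrix.vec p x)" using L by (auto simp: spd_mats_def)
    thus ?thesis using scalar_prod_eq_qform[OF c] by simp
  qed
  thus ?R using c symmetric_mat_index[OF t c] by blast
next
  assume R: ?R
  hence c: "Q \<in> carrier_mat p p" by blast
  have "0 < scalar_prod v (Q *\<^sub>v v)" if v: "v \<in> carrier_vec p" "v \<noteq> 0\<^sub>v p" for v
  proof -
    have e: "v = Matrix.vec p (\<lambda>i. v $ i)" using v by auto
    have "\<exists>i<p. v $ i \<noteq> 0" using v by (metis carrier_vecD eq_vecI index_zero_vec)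
    hence "0 < qform p Q (\<lambda>i. v $ i)" using R by blast
    thus ?thesis using scalar_prod_eq_qform[OF c] e by metis
  qed
  moreover have "transpose_mat Q = Q" using R by (intro eq_matI) auto
  ultimately show ?L using c by (auto simp: spd_mats_def)
qed

lemma spd_matsD:
  assumes "Q \<in> spd_mats p"
  shows "Q \<in> carrier_mat p p"
    and "i < p \<Longrightarrow> j < p \<Longrightarrow> Q $$ (i, j) = Q $$ (j, i)"
    and "i < p \<Longrightarrow> x i \<noteq> 0 \<Longrightarrow> 0 < qform p Q x"
  using assms unfolding spd_mats_iff by blast+

definition sym_mats :: "nat \<Rightarrow> real mat set" where
  "sym_mats p = {A \<in> carrier_mat p p. \<forall>i<p. \<forall>j<p. A $$ (i, j) = A $$ (j, i)}"

lemma sym_matsD: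
  assumes "A \<in> sym_mats p"
  shows "A \<in> carrier_mat p p" and "i < p \<Longrightarrow> j < p \<Longrightarrow> A $$ (i, j) = A $$ (j, i)"
  using assms unfolding sym_mats_def by blast+

lemma spd_imp_sym: "Q \<in> spd_mats p \<Longrightarrow> Q \<in> sym_mats p"
  unfolding sym_mats_def spd_mats_iff by blast

text \<open>For \<open>Q\<close> of dimension \<open>Suc p\<close>, with \<open>p\<close> as its
  last index, this is the matrix left on the first \<open>p\<close> coordinates once the square in
  the last coordinate has been completed.\<close>

definition schur_compl :: "nat \<Rightarrow> real mat \<Rightarrow> real mat" where
  "schur_compl p Q = mat p p (\<lambda>(i, j). Q $$ (i, j) - Q $$ (i, p) * Q $$ (p, j) / Q $$ (p, p))"

text \<open>Exposes the form as a quadratic polynomial in its last coordinate. The update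
  \<open>x(p := y)\<close> is the shape in which Fubini's theorem delivers the inner
  integral.\<close>

lemma qform_Suc:
  assumes Q: "Q \<in> sym_mats (Suc p)"
  shows "qform (Suc p) Q (x(p := y)) =
    qform p Q x + 2 * y * (\<Sum>i<p. Q $$ (i, p) * x i) + Q $$ (p, p) * y\<^sup>2"
proof -
  have s: "(\<Sum>j<p. y * Q $$ (p, j) * x j) = y * (\<Sum>i<p. Q $$ (i, p) * x i)"
    unfolding sum_distrib_left by (rule sum.cong) (use sym_matsD(2)[OF Q, of p] in auto)
  have s2: "(\<Sum>i<p. x i * Q $$ (i, p) * y) = y * (\<Sum>i<p. Q $$ (i, p) * x i)"
    unfolding sum_distrib_left by (rule sum.cong) auto
  have "qform (Suc p) Q (x(p := y)) =
    (\<Sum>i<p. (\<Sum>j<p. x i * Q $$ (i, j) * x j) + x i * Q $$ (i, p) * y)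
     + ((\<Sum>j<p. y * Q $$ (p, j) * x j) + y * Q $$ (p, p) * y)"
    by (simp add: qform_def)
  also have "\<dots> = qform p Q x + 2 * y * (\<Sum>i<p. Q $$ (i, p) * x i) + Q $$ (p, p) * y\<^sup>2"
    by (simp add: sum.distrib s s2 qform_def power2_eq_square)
  finally show ?thesis .
qed

text \<open>For a positive pivot, the right-hand side is the minimum over \<open>y\<close> of the
  polynomial in \<open>qform_Suc\<close>.\<close>

lemma qform_schur_compl:
  assumes Q: "Q \<in> sym_mats (Suc p)"
  shows "qform p (schur_compl p Q) x = qform p Q x - (\<Sum>i<p. Q $$ (i, p) * x i)\<^sup>2 / Q $$ (p, p)"
proof -
  have "qform p (schur_compl p Q) x = (\<Sum>i<p. \<Sum>j<p. x i * Q $$ (i, j) * x j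
      - (Q $$ (i, p) * x i) * (Q $$ (j, p) * x j) / Q $$ (p, p))"
    unfolding qform_def
  proof (intro sum.cong refl)
    fix i j assume ij: "i \<in> {..<p}" "j \<in> {..<p}"
    have "Q $$ (p, j) = Q $$ (j, p)" using sym_matsD(2)[OF Q, of p j] ij by simp
    thus "x i * schur_compl p Q $$ (i, j) * x j = x i * Q $$ (i, j) * x j
      - (Q $$ (i, p) * x i) * (Q $$ (j, p) * x j) / Q $$ (p, p)"
      using ij by (simp add: schur_compl_def left_diff_distrib right_diff_distrib)
  qed
  also have "\<dots> = qform p Q x - (\<Sum>i<p. Q $$ (i, p) * x i)\<^sup>2 / Q $$ (p, p)"
    by (simp add: sum_subtractf qform_def power2_eq_square sum_product sum_divide_distrib)
  finally show ?thesis .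
qed

lemma spd_mats_diag_pos:
  assumes "Q \<in> spd_mats p" "i < p"
  shows "0 < Q $$ (i, i)"
proof -
  have "0 < qform p Q (\<lambda>k. if k = i then 1 else 0)"
    using spd_matsD(3)[OF assms] by simp
  also have "\<dots> = Q $$ (i, i)" using assms(2)
    by (simp add: qform_def if_distrib[of "\<lambda>x. x * _"] if_distrib[of "\<lambda>x. _ * x"] cong: if_cong)
  finally show ?thesis .
qed

lemma schur_compl_spd:
  assumes Q: "Q \<in> spd_mats (Suc p)"
  shows "schur_compl p Q \<in> spd_mats p"
proof -
  note sym = spd_imp_sym[OF Q]
  have d: "0 < Q $$ (p, p)" using spd_mats_diag_pos[OF Q] by simp
  have "0 < qform p (schur_compl p Q) x" if x: "\<exists>i<p. x i \<noteq> 0" for x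
  proof -
    let ?b = "\<Sum>i<p. Q $$ (i, p) * x i"
    obtain i where "i < p" "x i \<noteq> 0" using x by blast
    \<comment> \<open>The last coordinate is the minimiser \<open>- ?b / Q $$ (p, p)\<close>, where
      the large form takes the value of the small one.\<close>
    hence "0 < qform (Suc p) Q (x(p := - ?b / Q $$ (p, p)))"
      by (intro spd_matsD(3)[OF Q, of i]) auto
    also have "\<dots> = qform p Q x + 2 * (- ?b / Q $$ (p, p)) * ?b + Q $$ (p, p) * (- ?b / Q $$ (p, p))\<^sup>2"
      by (rule qform_Suc[OF sym])
    also have "\<dots> = qform p Q x - ?b\<^sup>2 / Q $$ (p, p)"
      using d by (simp add: power2_eq_square)
    also have "\<dots> = qform p (schur_compl p Q) x"
      by (rule qform_schur_compl[OF sym, symmetric])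
    finally show ?thesis .
  qed
  moreover have "schur_compl p Q $$ (i, j) = schur_compl p Q $$ (j, i)" if "i < p" "j < p" for i j
    using that spd_matsD(2)[OF Q, of i j] spd_matsD(2)[OF Q, of i p] spd_matsD(2)[OF Q, of j p] by (simp add: schur_compl_def)
  moreover have "schur_compl p Q \<in> carrier_mat p p" by (simp add: schur_compl_def)
  ultimately show ?thesis by (simp add: spd_mats_iff)
qed

text \<open>One block step of Gaussian elimination on columns: the unit lower triangular
  \<open>U\<close> clears the last row of \<open>Q\<close> left of the pivot, so
  \<open>Q * U\<close> is block upper triangular with the Schur complement and the pivot on its
  diagonal.\<close>

lemma det_schur_compl:
  assumes Q: "Q \<in> carrier_mat (Suc p) (Suc p)" and d: "Q $$ (p, p) \<noteq> 0"
  shows "Determinant.det Q = Q $$ (p, p) * Determinant.det (schur_compl p Q)"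
proof -
  define U where "U = four_block_mat (1\<^sub>m p) (0\<^sub>m p 1)
     (mat 1 p (\<lambda>(_, j). - Q $$ (p, j) / Q $$ (p, p))) (1\<^sub>m 1)"
  define V where "V = four_block_mat (schur_compl p Q) (mat p 1 (\<lambda>(i, _). Q $$ (i, p)))
     (0\<^sub>m 1 p) (mat 1 1 (\<lambda>_. Q $$ (p, p)))"
  have U: "U \<in> carrier_mat (Suc p) (Suc p)"
    unfolding U_def using four_block_carrier_mat[of "1\<^sub>m p" p p "1\<^sub>m 1" 1 1] by simp
  have SC: "schur_compl p Q \<in> carrier_mat p p" by (simp add: schur_compl_def)
  have V: "V \<in> carrier_mat (Suc p) (Suc p)"
    unfolding V_def using four_block_carrier_mat[OF SC, of "mat 1 1 (\<lambda>_. Q $$ (p, p))" 1 1] by simp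
  have dU: "Determinant.det U = 1"
    unfolding U_def by (subst det_four_block_mat_upper_right_zero[of _ p _ 1]) auto
  have dV: "Determinant.det V = Determinant.det (schur_compl p Q) * Q $$ (p, p)"
    unfolding V_def
    by (subst det_four_block_mat_lower_left_zero[of _ p _ 1]) (auto simp: SC det_single)
  have "Q * U = V"
  proof (rule eq_matI)
    fix i j assume "i < dim_row V" "j < dim_col V"
    hence ij: "i < Suc p" "j < Suc p" using V by auto
    have "(Q * U) $$ (i, j) = (\<Sum>k<Suc p. Q $$ (i, k) * U $$ (k, j))"
      using Q U ij by (auto simp: scalar_prod_def lessThan_atLeast0 intro!: sum.cong)
    also have "\<dots> = (\<Sum>k<p. Q $$ (i, k) * (if k = j then 1 else 0)) + Q $$ (i, p) * U $$ (p, j)"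
      using ij by (auto simp: U_def four_block_mat_def intro!: sum.cong)
    also have "\<dots> = (if j < p then Q $$ (i, j) else 0) + Q $$ (i, p) * U $$ (p, j)"
      by (simp add: if_distrib[of "\<lambda>x. _ * x"] sum.delta' cong: if_cong)
    also have "\<dots> = V $$ (i, j)"
      using ij d by (auto simp: V_def U_def four_block_mat_def schur_compl_def less_Suc_eq)
    finally show "(Q * U) $$ (i, j) = V $$ (i, j)" .
  qed (use Q U V in auto)
  hence "Determinant.det V = Determinant.det Q * Determinant.det U"
    using det_mult[OF Q U] by simp
  thus ?thesis using dU dV by (simp add: mult.commute)
qed

text \<open>Completing the square makes the integrand a multiple of the normal density with mean
  \<open>- b / d\<close> and variance \<open>1 / d\<close>, whose total mass is 1.\<close>

lemma nn_integral_exp_quadratic: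
  fixes b d :: real
  assumes d: "0 < d"
  shows "(\<integral>\<^sup>+y. ennreal (exp (- (2 * y * b + d * y\<^sup>2) / 2)) \<partial>lborel) =
    ennreal (sqrt (2 * pi / d) * exp (b\<^sup>2 / (2 * d)))"
proof -
  let ?s = "1 / sqrt d" and ?m = "- b / d"
  have nd: "exp (- (2 * y * b + d * y\<^sup>2) / 2) =
      sqrt (2 * pi / d) * exp (b\<^sup>2 / (2 * d)) * normal_density ?m ?s y" for y
  proof -
    have "- (2 * y * b + d * y\<^sup>2) / 2 = b\<^sup>2 / (2 * d) + - (y - ?m)\<^sup>2 / (2 * ?s\<^sup>2)"
      using d by (simp add: field_simps power2_eq_square power_divide)
    thus ?thesis using d
      by (simp only: normal_density_def exp_add) (simp add: power_divide real_sqrt_divide)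
  qed
  interpret prob_space "density lborel (normal_density ?m ?s)"
    using d by (intro prob_space_normal_density) simp
  have one: "(\<integral>\<^sup>+y. ennreal (normal_density ?m ?s y) \<partial>lborel) = 1"
    using emeasure_space_1 by (simp add: emeasure_density)
  have "(\<integral>\<^sup>+y. ennreal (exp (- (2 * y * b + d * y\<^sup>2) / 2)) \<partial>lborel) =
    (\<integral>\<^sup>+y. ennreal (sqrt (2 * pi / d) * exp (b\<^sup>2 / (2 * d))) * ennreal (normal_density ?m ?s y) \<partial>lborel)"
    unfolding nd using d by (subst ennreal_mult) auto
  also have "\<dots> = ennreal (sqrt (2 * pi / d) * exp (b\<^sup>2 / (2 * d))) * (\<integral>\<^sup>+y. ennreal (normal_density ?m ?s y) \<partial>lborel)"
    by (rule nn_integral_cmult) measurable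
  also have "\<dots> = ennreal (sqrt (2 * pi / d) * exp (b\<^sup>2 / (2 * d)))"
    by (simp only: one mult_1_right)
  finally show ?thesis .
qed

lemma measurable_qform [measurable]:
  "qform p Q \<in> borel_measurable (Pi\<^sub>M {..<p} (\<lambda>_. lborel))"
  unfolding qform_def [abs_def] by measurable

text \<open>Induction on the dimension: integrating out the last coordinate yields
  \<open>sqrt (2 * pi / d)\<close> and leaves the form of the Schur complement, while the
  determinant loses the same pivot \<open>d\<close>. Positivity of the determinant follows by the
  same recursion and is needed under the root.\<close>

lemma gaussian_integral_spd:
  assumes "Q \<in> spd_mats p"
  shows "0 < Determinant.det Q \<and>
    (\<integral>\<^sup>+x. ennreal (exp (- qform p Q x / 2)) \<partial>Pi\<^sub>M {..<p} (\<lambda>_. lborel)) =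
      ennreal (sqrt ((2 * pi) ^ p / Determinant.det Q))"
  using assms
proof (induction p arbitrary: Q)
  case 0
  hence "Q \<in> carrier_mat 0 0" by (simp add: spd_mats_def)
  hence "Determinant.det Q = 1" by (rule det_dim_zero)
  thus ?case by (simp add: qform_def PiM_empty)
next
  case (Suc p)
  interpret L: product_sigma_finite "\<lambda>_::nat. lborel :: real measure" by standard
  define S where "S = schur_compl p Q"
  define d where "d = Q $$ (p, p)"
  note sym = spd_imp_sym[OF Suc.prems]
  have d: "0 < d" unfolding d_def using spd_mats_diag_pos[OF Suc.prems] by simp
  have IH: "0 < Determinant.det S"
    "(\<integral>\<^sup>+x. ennreal (exp (- qform p S x / 2)) \<partial>Pi\<^sub>M {..<p} (\<lambda>_. lborel)) =
      ennreal (sqrt ((2 * pi) ^ p / Determinant.det S))"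
    unfolding S_def using Suc.IH[OF schur_compl_spd[OF Suc.prems]] by auto
  have det: "Determinant.det Q = d * Determinant.det S"
    unfolding d_def S_def using Suc.prems d
    by (intro det_schur_compl spd_matsD(1)) (auto simp: d_def)
  have "(\<integral>\<^sup>+x. ennreal (exp (- qform (Suc p) Q x / 2)) \<partial>Pi\<^sub>M {..<Suc p} (\<lambda>_. lborel)) =
    (\<integral>\<^sup>+x. (\<integral>\<^sup>+y. ennreal (exp (- qform (Suc p) Q (x(p := y)) / 2)) \<partial>lborel) \<partial>Pi\<^sub>M {..<p} (\<lambda>_. lborel))"
    unfolding lessThan_Suc
    by (rule L.product_nn_integral_insert) (auto simp flip: lessThan_Suc)
  also have "\<dots> = (\<integral>\<^sup>+x. ennreal (sqrt (2 * pi / d)) * ennreal (exp (- qform p S x / 2))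
      \<partial>Pi\<^sub>M {..<p} (\<lambda>_. lborel))"
  proof (rule nn_integral_cong)
    fix x :: "nat \<Rightarrow> real"
    define b where "b = (\<Sum>i<p. Q $$ (i, p) * x i)"
    have "(\<integral>\<^sup>+y. ennreal (exp (- qform (Suc p) Q (x(p := y)) / 2)) \<partial>lborel) =
      (\<integral>\<^sup>+y. ennreal (exp (- qform p Q x / 2)) * ennreal (exp (- (2 * y * b + d * y\<^sup>2) / 2)) \<partial>lborel)"
      unfolding qform_Suc[OF sym] b_def d_def
      by (simp add: ennreal_mult[symmetric] exp_add[symmetric] add_divide_distrib diff_divide_distrib algebra_simps)
    also have "\<dots> = ennreal (exp (- qform p Q x / 2)) * ennreal (sqrt (2 * pi / d) * exp (b\<^sup>2 / (2 * d)))"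
      unfolding nn_integral_exp_quadratic[OF d, of b, symmetric] by (rule nn_integral_cmult) measurable
    also have "\<dots> = ennreal (sqrt (2 * pi / d)) * ennreal (exp (- qform p S x / 2))"
      using d unfolding S_def qform_schur_compl[OF sym] b_def[symmetric] d_def[symmetric]
      by (simp add: ennreal_mult[symmetric] exp_add[symmetric] mult.left_commute field_simps)
    finally show "(\<integral>\<^sup>+y. ennreal (exp (- qform (Suc p) Q (x(p := y)) / 2)) \<partial>lborel) =
      ennreal (sqrt (2 * pi / d)) * ennreal (exp (- qform p S x / 2))" .
  qed
  also have "\<dots> = ennreal (sqrt (2 * pi / d)) * ennreal (sqrt ((2 * pi) ^ p / Determinant.det S))"
    unfolding IH(2)[symmetric] by (rule nn_integral_cmult) measurable
  also have "\<dots> = ennreal (sqrt ((2 * pi) ^ Suc p / Determinant.det Q))"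
    using d IH(1) by (simp add: ennreal_mult[symmetric] real_sqrt_mult[symmetric] det)
  finally show ?case using det d IH(1) by simp
qed

section \<open>Row-sum bounds and the exponential moment of a quadratic form\<close>

definition mv :: "nat \<Rightarrow> real mat \<Rightarrow> (nat \<Rightarrow> real) \<Rightarrow> nat \<Rightarrow> real" where
  "mv p M x i = (\<Sum>j<p. M $$ (i, j) * x j)"

text \<open>A bound on the operator norm for the maximum norm. It is easy to compute for band
  matrices, is submultiplicative, and dominates the eigenvalues.\<close>

definition abs_row_sums_le :: "nat \<Rightarrow> real mat \<Rightarrow> real \<Rightarrow> bool" where
  "abs_row_sums_le p M a \<longleftrightarrow> (\<forall>i<p. (\<Sum>j<p. \<bar>M $$ (i, j)\<bar>) \<le> a)"

lemma qform_eq_mv: "qform p M x = (\<Sum>i<p. x i * mv p M x i)"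
  by (simp add: qform_def mv_def sum_distrib_left mult.assoc)

lemma mv_index_mult:
  assumes "M \<in> carrier_mat p p" "N \<in> carrier_mat p p" "i < p"
  shows "mv p M (mv p N x) i = mv p (M * N) x i"
proof -
  have "mv p M (mv p N x) i = (\<Sum>k<p. \<Sum>j<p. M $$ (i, k) * N $$ (k, j) * x j)"
    by (simp add: mv_def sum_distrib_left mult.assoc)
  also have "\<dots> = (\<Sum>j<p. \<Sum>k<p. M $$ (i, k) * N $$ (k, j) * x j)"
    by (rule sum.swap)
  also have "\<dots> = mv p (M * N) x i"
    using assms by (auto simp: mv_def scalar_prod_def sum_distrib_right lessThan_atLeast0 intro!: sum.cong)
  finally show ?thesis .
qed

lemma mv_one: "i < p \<Longrightarrow> mv p (1\<^sub>m p) x i = x i"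
  by (simp add: mv_def if_distrib[of "\<lambda>x. x * _"] cong: if_cong)

lemma abs_row_sums_le_mult:
  assumes "A \<in> carrier_mat p p" "B \<in> carrier_mat p p"
    and A: "abs_row_sums_le p A a" and B: "abs_row_sums_le p B b" and "0 \<le> b"
  shows "abs_row_sums_le p (A * B) (a * b)"
  unfolding abs_row_sums_le_def
proof (intro allI impI)
  fix i assume i: "i < p"
  have "(\<Sum>j<p. \<bar>(A * B) $$ (i, j)\<bar>) \<le> (\<Sum>j<p. \<Sum>k<p. \<bar>A $$ (i, k)\<bar> * \<bar>B $$ (k, j)\<bar>)"
  proof (rule sum_mono)
    fix j assume "j \<in> {..<p}"
    hence "(A * B) $$ (i, j) = (\<Sum>k<p. A $$ (i, k) * B $$ (k, j))"
      using assms i by (auto simp: scalar_prod_def lessThan_atLeast0)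
    thus "\<bar>(A * B) $$ (i, j)\<bar> \<le> (\<Sum>k<p. \<bar>A $$ (i, k)\<bar> * \<bar>B $$ (k, j)\<bar>)"
      using sum_abs[of "\<lambda>k. A $$ (i, k) * B $$ (k, j)" "{..<p}"] by (simp add: abs_mult)
  qed
  also have "\<dots> = (\<Sum>k<p. \<bar>A $$ (i, k)\<bar> * (\<Sum>j<p. \<bar>B $$ (k, j)\<bar>))"
    by (subst sum.swap) (simp add: sum_distrib_left)
  also have "\<dots> \<le> (\<Sum>k<p. \<bar>A $$ (i, k)\<bar> * b)"
    using B by (intro sum_mono mult_left_mono) (auto simp: abs_row_sums_le_def)
  also have "\<dots> = (\<Sum>k<p. \<bar>A $$ (i, k)\<bar>) * b"
    by (simp add: sum_distrib_right)
  also have "\<dots> \<le> a * b"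
    using A i \<open>0 \<le> b\<close> by (intro mult_right_mono) (auto simp: abs_row_sums_le_def)
  finally show "(\<Sum>j<p. \<bar>(A * B) $$ (i, j)\<bar>) \<le> a * b" .
qed

text \<open>The Schur test: each product of two coordinates is at most half the sum of their
  squares, and by symmetry both halves contribute the same row-sum expression.\<close>

lemma abs_qform_le:
  assumes A: "A \<in> sym_mats p" and a: "abs_row_sums_le p A a"
  shows "\<bar>qform p A x\<bar> \<le> a * (\<Sum>i<p. (x i)\<^sup>2)"
proof -
  have "\<bar>qform p A x\<bar> \<le> (\<Sum>i<p. \<Sum>j<p. \<bar>x i * A $$ (i, j) * x j\<bar>)"
    unfolding qform_def by (rule order_trans[OF sum_abs]) (intro sum_mono sum_abs)
  also have "\<dots> \<le> (\<Sum>i<p. \<Sum>j<p. \<bar>A $$ (i, j)\<bar> * (x i)\<^sup>2 / 2 + \<bar>A $$ (i, j)\<bar> * (x j)\<^sup>2 / 2)"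
  proof (intro sum_mono)
    fix i j
    have "\<bar>x i\<bar> * \<bar>x j\<bar> \<le> (x i)\<^sup>2 / 2 + (x j)\<^sup>2 / 2"
      using sum_squares_bound[of "\<bar>x i\<bar>" "\<bar>x j\<bar>"] by simp
    hence "\<bar>A $$ (i, j)\<bar> * (\<bar>x i\<bar> * \<bar>x j\<bar>) \<le> \<bar>A $$ (i, j)\<bar> * ((x i)\<^sup>2 / 2 + (x j)\<^sup>2 / 2)"
      by (rule mult_left_mono) simp
    thus "\<bar>x i * A $$ (i, j) * x j\<bar> \<le> \<bar>A $$ (i, j)\<bar> * (x i)\<^sup>2 / 2 + \<bar>A $$ (i, j)\<bar> * (x j)\<^sup>2 / 2"
      by (simp add: abs_mult algebra_simps)
  qed
  also have "\<dots> = (\<Sum>i<p. \<Sum>j<p. \<bar>A $$ (i, j)\<bar> * (x i)\<^sup>2 / 2) + (\<Sum>i<p. \<Sum>j<p. \<bar>A $$ (i, j)\<bar> * (x j)\<^sup>2 / 2)"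
    by (simp add: sum.distrib)
  also have "(\<Sum>i<p. \<Sum>j<p. \<bar>A $$ (i, j)\<bar> * (x j)\<^sup>2 / 2) = (\<Sum>i<p. \<Sum>j<p. \<bar>A $$ (i, j)\<bar> * (x i)\<^sup>2 / 2)"
    by (subst sum.swap) (intro sum.cong refl, simp add: sym_matsD(2)[OF A])
  also have "(\<Sum>i<p. \<Sum>j<p. \<bar>A $$ (i, j)\<bar> * (x i)\<^sup>2 / 2) + (\<Sum>i<p. \<Sum>j<p. \<bar>A $$ (i, j)\<bar> * (x i)\<^sup>2 / 2)
      = (\<Sum>i<p. (\<Sum>j<p. \<bar>A $$ (i, j)\<bar>) * (x i)\<^sup>2)"
    by (simp add: sum.distrib[symmetric] sum_distrib_right)
  also have "\<dots> \<le> (\<Sum>i<p. a * (x i)\<^sup>2)"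
    using a by (intro sum_mono mult_right_mono) (auto simp: abs_row_sums_le_def)
  finally show ?thesis by (simp add: sum_distrib_left)
qed

lemma qform_diff_scaled:
  assumes A: "A \<in> sym_mats p"
  shows "qform p A (\<lambda>i. x i - c * z i) = qform p A x - 2 * c * (\<Sum>i<p. z i * mv p A x i) + c\<^sup>2 * qform p A z"
proof -
  have e: "(\<Sum>i<p. x i * mv p A z i) = (\<Sum>i<p. z i * mv p A x i)"
    unfolding mv_def sum_distrib_left
    by (subst sum.swap) (intro sum.cong refl, simp add: sym_matsD(2)[OF A])
  have m: "mv p A (\<lambda>i. x i - c * z i) i = mv p A x i - c * mv p A z i" for i
    by (simp add: mv_def right_diff_distrib sum_subtractf sum_distrib_left mult.left_commute)
  have "qform p A (\<lambda>i. x i - c * z i) = (\<Sum>i<p. x i * mv p A x i - c * (x i * mv p A z i)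
     - c * (z i * mv p A x i) + c\<^sup>2 * (z i * mv p A z i))"
    unfolding qform_eq_mv m by (intro sum.cong refl) (simp add: algebra_simps power2_eq_square)
  also have "\<dots> = qform p A x - c * (\<Sum>i<p. x i * mv p A z i) - c * (\<Sum>i<p. z i * mv p A x i) + c\<^sup>2 * qform p A z"
    by (simp add: sum.distrib sum_subtractf sum_distrib_left qform_eq_mv)
  finally show ?thesis unfolding e by simp
qed

lemma spd_mats_qform_nonneg: "Q \<in> spd_mats p \<Longrightarrow> 0 \<le> qform p Q x"
  by (cases "\<exists>i<p. x i \<noteq> 0") (auto simp: qform_def dest: spd_matsD(3)[of Q p _ x] less_imp_le)

text \<open>This is the operator inequality \<open>S\<^sup>2 \<le> b S\<close>. It follows from
  nonnegativity of the form at \<open>y - S y / b\<close>, without a matrix square root.\<close>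

lemma sum_mv_squared_le:
  assumes S: "S \<in> spd_mats p" and b: "abs_row_sums_le p S b" "0 < b"
  shows "(\<Sum>i<p. (mv p S y i)\<^sup>2) \<le> b * qform p S y"
proof -
  let ?z = "mv p S y" and ?N = "\<Sum>i<p. (mv p S y i)\<^sup>2"
  \<comment> \<open>The coefficient \<open>1 / b\<close> minimises the upper bound
    \<open>qform p S y - 2 * c * ?N + c\<^sup>2 * b * ?N\<close> over \<open>c\<close>.\<close>
  have "0 \<le> qform p S (\<lambda>i. y i - (1 / b) * ?z i)"
    using S by (rule spd_mats_qform_nonneg)
  also have "\<dots> = qform p S y - 2 * (1 / b) * ?N + (1 / b)\<^sup>2 * qform p S ?z"
    unfolding qform_diff_scaled[OF spd_imp_sym[OF S]] by (simp add: power2_eq_square)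
  also have "\<dots> \<le> qform p S y - 2 * (1 / b) * ?N + (1 / b)\<^sup>2 * (b * ?N)"
    using abs_qform_le[OF spd_imp_sym[OF S] b(1), of ?z] by (intro add_left_mono mult_left_mono) auto
  also have "\<dots> = qform p S y - ?N / b"
    using b by (simp add: power2_eq_square)
  finally show ?thesis using b by (simp add: field_simps)
qed

lemma spd_mats_inverse:
  assumes S: "S \<in> spd_mats p"
  obtains T where "mat_inverse S = Some T" "T \<in> sym_mats p" "S * T = 1\<^sub>m p" "T * S = 1\<^sub>m p"
proof -
  have c: "S \<in> carrier_mat p p" using spd_matsD(1)[OF S] .
  have "Determinant.det S \<noteq> 0" using gaussian_integral_spd[OF S] by simp
  hence "S \<in> Units (ring_mat TYPE(real) p ())" by (rule det_non_zero_imp_unit[OF c])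
  then obtain T where T: "mat_inverse S = Some T" using mat_inverse(1)[OF c, where b = "()"] by (cases "mat_inverse S") auto
  note inv = mat_inverse(2)[OF c T]
  have tS: "transpose_mat S = S" using S by (simp add: spd_mats_def)
  have Tc: "T \<in> carrier_mat p p" using inv by blast
  \<comment> \<open>Transposing \<open>S * T = 1\<close> makes the transpose of \<open>T\<close> a
    left inverse of \<open>S\<close>, so it coincides with \<open>T\<close>.\<close>
  have tT: "transpose_mat T * S = 1\<^sub>m p"
    using transpose_mult[OF c Tc] inv tS by simp
  have "transpose_mat T = transpose_mat T * (S * T)" using inv Tc by simp
  also have "\<dots> = (transpose_mat T * S) * T"
    using c Tc by (simp add: assoc_mult_mat[of _ p p _ p _ p])
  also have "\<dots> = T" unfolding tT using Tc by simp
  finally have "T \<in> sym_mats p"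
    using Tc symmetric_mat_index[of T p] by (auto simp: sym_mats_def)
  thus ?thesis using that T inv by blast
qed

lemma qform_minus:
  assumes "A \<in> carrier_mat p p" "B \<in> carrier_mat p p"
  shows "qform p (A - B) x = qform p A x - qform p B x"
  using assms by (simp add: qform_def sum_subtractf[symmetric] algebra_simps)

text \<open>\<open>T\<close> is the inverse of \<open>S\<close>, and this matrix is the precision of
  the tilted Gaussian. Writing \<open>x = S y\<close> turns the form of \<open>T\<close> at
  \<open>x\<close> into that of \<open>S\<close> at \<open>y\<close>, whereas the form of
  \<open>A\<close> at \<open>x\<close> is at most \<open>a\<close> times the squared norm of
  \<open>S y\<close>, hence at most \<open>a * b\<close> times the form of \<open>S\<close> at
  \<open>y\<close>.\<close>

lemma inverse_minus_spd:
  assumes S: "S \<in> spd_mats p" and A: "A \<in> sym_mats p"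
    and T: "T \<in> sym_mats p" "S * T = 1\<^sub>m p"
    and a: "abs_row_sums_le p A a" and b: "abs_row_sums_le p S b" "0 < b" and ab: "a * b < 1" "0 \<le> a"
  shows "T - A \<in> spd_mats p"
proof -
  have Sc: "S \<in> carrier_mat p p" using spd_matsD(1)[OF S] .
  note Ac = sym_matsD(1)[OF A] and Tc = sym_matsD(1)[OF T(1)]
  have "0 < qform p (T - A) x" if x: "i < p" "x i \<noteq> 0" for x i
  proof -
    let ?y = "mv p T x"
    have xy: "mv p S ?y k = x k" if "k < p" for k
      using mv_index_mult[OF Sc Tc that] T(2) mv_one[OF that] by simp
    have "\<exists>k<p. ?y k \<noteq> 0"
    proof (rule ccontr)
      assume "\<not> ?thesis"
      hence "mv p S ?y i = 0" by (simp add: mv_def)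
      thus False using xy x by simp
    qed
    hence pos: "0 < qform p S ?y" using spd_matsD(3)[OF S] by blast
    have qT: "qform p T x = qform p S ?y"
    proof -
      have "qform p T x = (\<Sum>i<p. x i * ?y i)" by (rule qform_eq_mv)
      also have "\<dots> = (\<Sum>i<p. ?y i * mv p S ?y i)"
        by (intro sum.cong refl) (simp add: xy)
      finally show ?thesis by (simp add: qform_eq_mv)
    qed
    have "qform p A x \<le> a * (\<Sum>i<p. (x i)\<^sup>2)" using abs_qform_le[OF A a, of x] by simp
    also have "(\<Sum>i<p. (x i)\<^sup>2) = (\<Sum>i<p. (mv p S ?y i)\<^sup>2)"
      by (intro sum.cong refl) (simp add: xy)
    also have "a * \<dots> \<le> a * (b * qform p S ?y)"
      using sum_mv_squared_le[OF S b] ab by (intro mult_left_mono) auto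
    also have "\<dots> = (a * b) * qform p S ?y" by simp
    also have "\<dots> < 1 * qform p S ?y" using ab pos by (intro mult_strict_right_mono) auto
    finally show ?thesis using qform_minus[OF Tc Ac] qT by simp
  qed
  moreover have "(T - A) $$ (i, j) = (T - A) $$ (j, i)" if "i < p" "j < p" for i j
    using that Ac Tc sym_matsD(2)[OF A, of i j] sym_matsD(2)[OF T(1), of i j] by simp
  ultimately show ?thesis using Ac Tc unfolding spd_mats_iff by auto
qed

text \<open>Multiplying the density by the exponential replaces the precision \<open>T\<close> by
  \<open>T - A\<close>, so the moment is a ratio of two Gaussian integrals. The determinants combine
  through \<open>(T - A) * S = 1 - A * S\<close>.\<close>

lemma gauss_vec_mgf:
  assumes S: "S \<in> spd_mats p" and A: "A \<in> sym_mats p"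
    and a: "abs_row_sums_le p A a" and b: "abs_row_sums_le p S b" "0 < b" and ab: "a * b < 1" "0 \<le> a"
  shows "0 < Determinant.det (1\<^sub>m p - A * S)"
    and "(\<integral>\<^sup>+x. ennreal (exp (qform p A x / 2)) \<partial>gauss_vec p S) =
      ennreal (1 / sqrt (Determinant.det (1\<^sub>m p - A * S)))"
proof -
  obtain T where T: "mat_inverse S = Some T" "T \<in> sym_mats p" "S * T = 1\<^sub>m p" "T * S = 1\<^sub>m p"
    using spd_mats_inverse[OF S] .
  have Sc: "S \<in> carrier_mat p p" using spd_matsD(1)[OF S] .
  note Ac = sym_matsD(1)[OF A] and Tc = sym_matsD(1)[OF T(2)]
  note g = gaussian_integral_spd[OF inverse_minus_spd[OF S A T(2,3) a b ab]]
  have dS: "0 < Determinant.det S" using gaussian_integral_spd[OF S] by simp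
  have "(T - A) * S = 1\<^sub>m p - A * S"
    using minus_mult_distrib_mat[OF Tc Ac Sc] T(4) by simp
  hence d: "Determinant.det (1\<^sub>m p - A * S) = Determinant.det (T - A) * Determinant.det S"
    using det_mult[OF minus_carrier_mat[OF Ac, of T] Sc] by simp
  show "0 < Determinant.det (1\<^sub>m p - A * S)" unfolding d using g dS by simp
  let ?c = "sqrt ((2 * pi) ^ p * Determinant.det S)"
  have c: "0 < ?c" using dS by simp
  have dens: "exp (- scalar_prod (Matrix.vec p x) (the (mat_inverse S) *\<^sub>v Matrix.vec p x) / 2) / ?c =
      exp (- qform p T x / 2) / ?c" for x
    using scalar_prod_eq_qform[OF Tc, of x] T(1) by simp
  have "(\<integral>\<^sup>+x. ennreal (exp (qform p A x / 2)) \<partial>gauss_vec p S) =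
    (\<integral>\<^sup>+x. ennreal (exp (- qform p T x / 2) / ?c) * ennreal (exp (qform p A x / 2)) \<partial>Pi\<^sub>M {..<p} (\<lambda>_. lborel))"
    unfolding gauss_vec_def dens by (rule nn_integral_density) measurable
  also have "\<dots> = (\<integral>\<^sup>+x. ennreal (1 / ?c) * ennreal (exp (- qform p (T - A) x / 2)) \<partial>Pi\<^sub>M {..<p} (\<lambda>_. lborel))"
    using c by (intro nn_integral_cong)
      (simp add: ennreal_mult[symmetric] exp_add[symmetric] qform_minus[OF Tc Ac] diff_divide_distrib)
  also have "\<dots> = ennreal (1 / ?c) * ennreal (sqrt ((2 * pi) ^ p / Determinant.det (T - A)))"
    unfolding conjunct2[OF g, symmetric] by (rule nn_integral_cmult) measurable
  also have "\<dots> = ennreal (1 / sqrt (Determinant.det (1\<^sub>m p - A * S)))"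
    unfolding d using c g by (simp add: ennreal_mult[symmetric] real_sqrt_mult real_sqrt_divide mult.commute)
  finally show "(\<integral>\<^sup>+x. ennreal (exp (qform p A x / 2)) \<partial>gauss_vec p S) =
      ennreal (1 / sqrt (Determinant.det (1\<^sub>m p - A * S)))" .
qed

lemma abs_row_sums_le_exists: "\<exists>b>0. abs_row_sums_le p M b"
proof -
  let ?b = "1 + (\<Sum>i<p. \<Sum>j<p. \<bar>M $$ (i, j)\<bar>)"
  have "(\<Sum>j<p. \<bar>M $$ (i, j)\<bar>) \<le> (\<Sum>i<p. \<Sum>j<p. \<bar>M $$ (i, j)\<bar>)" if "i < p" for i
    using that by (intro member_le_sum) (auto intro: sum_nonneg)
  hence "abs_row_sums_le p M ?b" unfolding abs_row_sums_le_def by (smt (verit))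
  moreover have "0 < ?b" by (simp add: add_pos_nonneg sum_nonneg)
  ultimately show ?thesis by blast
qed

text \<open>The total mass is the moment formula at the zero matrix.\<close>

lemma prob_space_gauss_vec:
  assumes S: "S \<in> spd_mats p"
  shows "prob_space (gauss_vec p S)"
proof
  have z: "0\<^sub>m p p \<in> sym_mats p" "abs_row_sums_le p (0\<^sub>m p p) 0"
    by (auto simp: sym_mats_def abs_row_sums_le_def)
  obtain b where b: "0 < b" "abs_row_sums_le p S b" using abs_row_sums_le_exists by blast
  have "qform p (0\<^sub>m p p) x = 0" for x by (simp add: qform_def)
  moreover have "1\<^sub>m p - 0\<^sub>m p p * S = 1\<^sub>m p"
    using spd_matsD(1)[OF S] by auto
  ultimately have "(\<integral>\<^sup>+x. 1 \<partial>gauss_vec p S) = 1"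
    using gauss_vec_mgf(2)[OF S z b(2,1)] by simp
  thus "emeasure (gauss_vec p S) (space (gauss_vec p S)) = 1" by simp
qed

section \<open>Eigenvalue bounds and the determinant\<close>

lemma ln_one_minus_ge:
  fixes r :: real
  assumes "\<bar>r\<bar> \<le> 1 / 2"
  shows "- r - r\<^sup>2 \<le> ln (1 - r)"
proof -
  define f where "f x = ln (1 - x) + x + x\<^sup>2" for x :: real
  \<comment> \<open>On the interval from -1/2 to 1/2 this derivative has the sign of
    \<open>x\<close>, so \<open>f\<close> attains its minimum, 0, at the origin.\<close>
  have D: "(f has_real_derivative x * (1 - 2 * x) / (1 - x)) (at x)" if "x < 1" for x
    unfolding f_def using that
    by (auto intro!: derivative_eq_intros simp: divide_simps) (simp add: algebra_simps)
  have "f 0 \<le> f r"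
  proof (cases "0 \<le> r")
    case True
    show ?thesis
    proof (rule DERIV_nonneg_imp_nondecreasing[OF True])
      fix x assume "0 \<le> x" "x \<le> r"
      thus "\<exists>y. (f has_real_derivative y) (at x) \<and> 0 \<le> y"
        using assms by (intro exI[of _ "x * (1 - 2 * x) / (1 - x)"] conjI D) (auto intro!: mult_nonneg_nonneg)
    qed
  next
    case False
    hence "r \<le> 0" by simp
    thus ?thesis
    proof (rule DERIV_nonpos_imp_nonincreasing)
      fix x assume "r \<le> x" "x \<le> 0"
      thus "\<exists>y. (f has_real_derivative y) (at x) \<and> y \<le> 0"
        using assms by (intro exI[of _ "x * (1 - 2 * x) / (1 - x)"] conjI D)
          (auto intro!: divide_nonpos_pos mult_nonpos_nonneg)
    qed
  qed
  thus ?thesis by (simp add: f_def)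
qed

lemma exp_le_one_minus:
  fixes r :: real
  assumes "\<bar>r\<bar> \<le> 1 / 2"
  shows "exp (- r - r\<^sup>2) \<le> 1 - r"
  using ln_one_minus_ge[OF assms] assms by (subst ln_ge_iff[symmetric]) auto

section \<open>Traces and determinants in terms of eigenvalues\<close>

lemma trace_mult_commute:
  fixes A B :: "'a :: comm_ring_1 mat"
  assumes "A \<in> carrier_mat n n" "B \<in> carrier_mat n n"
  shows "(\<Sum>i<n. (A * B) $$ (i, i)) = (\<Sum>i<n. (B * A) $$ (i, i))"
proof -
  have e: "(\<Sum>i<n. (X * Y) $$ (i, i)) = (\<Sum>i<n. \<Sum>k<n. X $$ (i, k) * Y $$ (k, i))"
    if "X \<in> carrier_mat n n" "Y \<in> carrier_mat n n" for X Y :: "'a mat"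
    using that by (intro sum.cong) (auto simp: scalar_prod_def lessThan_atLeast0)
  show ?thesis unfolding e[OF assms] e[OF assms(2,1)]
    by (subst sum.swap) (simp add: mult.commute)
qed

lemma similar_mat_wit_trace:
  fixes A B :: "'a :: comm_ring_1 mat"
  assumes sim: "similar_mat_wit A B P Q" and A: "A \<in> carrier_mat n n"
  shows "(\<Sum>i<n. A $$ (i, i)) = (\<Sum>i<n. B $$ (i, i))"
proof -
  note w = similar_mat_witD2[OF A sim]
  have "(\<Sum>i<n. A $$ (i, i)) = (\<Sum>i<n. (Q * (P * B)) $$ (i, i))"
    unfolding w(3) using w by (intro trace_mult_commute) auto
  also have "Q * (P * B) = B"
    using w by (subst assoc_mult_mat[symmetric]) auto
  finally show ?thesis .
qed

text \<open>Schur's triangularisation puts the eigenvalues on the diagonal of \<open>B\<close>. The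
  trace is invariant under similarity, and squaring a triangular matrix squares its diagonal
  entries.\<close>

lemma trace_eq_sum_eigenvalues:
  fixes C :: "complex mat"
  assumes C: "C \<in> carrier_mat n n" and es: "char_poly C = (\<Prod>e\<leftarrow>es. [:- e, 1:])"
  shows "(\<Sum>i<n. C $$ (i, i)) = (\<Sum>e\<leftarrow>es. e)"
    and "(\<Sum>i<n. (C * C) $$ (i, i)) = (\<Sum>e\<leftarrow>es. e\<^sup>2)"
proof -
  obtain B P Q where s: "schur_decomposition C es = (B, P, Q)" by (cases "schur_decomposition C es")
  from schur_decomposition[OF C es s]
  have sim: "similar_mat_wit C B P Q" and ut: "upper_triangular B" and dg: "diag_mat B = es" by auto
  note w = similar_mat_witD2[OF C sim]
  have es_map: "es = map (\<lambda>i. B $$ (i, i)) [0..<n]"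
    using dg w(5) by (simp add: diag_mat_def)
  have sl: "(\<Sum>e\<leftarrow>es. g e) = (\<Sum>i<n. g (B $$ (i, i)))" for g :: "complex \<Rightarrow> complex"
    unfolding es_map by (simp add: interv_sum_list_conv_sum_set_nat lessThan_atLeast0 o_def)
  show "(\<Sum>i<n. C $$ (i, i)) = (\<Sum>e\<leftarrow>es. e)"
    unfolding sl by (rule similar_mat_wit_trace[OF sim C])
  have "C * C = P * (B * B) * Q"
  proof -
    have "C * C = (P * B * Q) * (P * B * Q)" using w(3) by simp
    also have "\<dots> = P * B * (Q * P) * B * Q"
      using w(4-7) by (simp add: assoc_mult_mat[of _ n n _ n _ n])
    also have "\<dots> = P * (B * B) * Q"
      unfolding w(2) using w(4-7) by (simp add: assoc_mult_mat[of _ n n _ n _ n])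
    finally show ?thesis .
  qed
  hence "similar_mat_wit (C * C) (B * B) P Q"
    using w by (intro similar_mat_witI[of _ _ n]) auto
  hence "(\<Sum>i<n. (C * C) $$ (i, i)) = (\<Sum>i<n. (B * B) $$ (i, i))"
    by (rule similar_mat_wit_trace) (use C in auto)
  also have "\<dots> = (\<Sum>i<n. (B $$ (i, i))\<^sup>2)"
  proof (rule sum.cong[OF refl])
    fix i assume i: "i \<in> {..<n}"
    have "(B * B) $$ (i, i) = (\<Sum>k<n. B $$ (i, k) * B $$ (k, i))"
      using w(5) i by (auto simp: scalar_prod_def lessThan_atLeast0)
    also have "\<dots> = (\<Sum>k\<in>{i}. B $$ (i, k) * B $$ (k, i))"
    proof (rule sum.mono_neutral_right)
      \<comment> \<open>For \<open>k\<close> different from \<open>i\<close>, one of the two factors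
        lies below the diagonal.\<close>
      show "\<forall>k\<in>{..<n} - {i}. B $$ (i, k) * B $$ (k, i) = 0"
      proof
        fix k assume k: "k \<in> {..<n} - {i}"
        hence "k < i \<or> i < k" by auto
        thus "B $$ (i, k) * B $$ (k, i) = 0"
          using upper_triangularD[OF ut, of k i] upper_triangularD[OF ut, of i k] w(5) i k by auto
      qed
    qed (use i in auto)
    finally show "(B * B) $$ (i, i) = (B $$ (i, i))\<^sup>2" by (simp add: power2_eq_square)
  qed
  finally show "(\<Sum>i<n. (C * C) $$ (i, i)) = (\<Sum>e\<leftarrow>es. e\<^sup>2)" unfolding sl .
qed

text \<open>The determinant is the product of \<open>1 - r\<close> over the eigenvalues
  \<open>r\<close>, and \<open>exp_le_one_minus\<close> applies to each factor. The detour through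
  complex matrices makes the characteristic polynomial split; the roots are then cast back to
  reals.\<close>

lemma det_one_minus_ge_exp_trace:
  assumes B: "B \<in> carrier_mat n n"
    and real: "\<And>e. eigenvalue (map_mat complex_of_real B) e \<Longrightarrow> e \<in> \<real> \<and> norm e \<le> 1 / 2"
  shows "exp (- (\<Sum>i<n. B $$ (i, i)) - (\<Sum>i<n. (B * B) $$ (i, i))) \<le> Determinant.det (1\<^sub>m n - B)"
proof -
  let ?C = "map_mat complex_of_real B"
  have C: "?C \<in> carrier_mat n n" using B by simp
  obtain es where es: "char_poly ?C = (\<Prod>e\<leftarrow>es. [:- e, 1:])" using char_poly_factorized[OF C] by blast
  define rs where "rs = map Re es"
  have rr: "e = complex_of_real (Re e) \<and> \<bar>Re e\<bar> \<le> 1 / 2" if "e \<in> set es" for e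
  proof -
    have "poly (char_poly ?C) e = 0"
      unfolding es poly_prod_list using that by (auto simp: prod_list_zero_iff)
    hence "eigenvalue ?C e" using eigenvalue_root_char_poly[OF C] by simp
    thus ?thesis using real[of e] abs_Re_le_cmod[of e] by (auto simp: complex_is_Real_iff complex_eq_iff)
  qed
  hence es_rs: "es = map complex_of_real rs"
    unfolding rs_def by (simp add: map_idI)
  have rb: "\<bar>r\<bar> \<le> 1 / 2" if "r \<in> set rs" for r using that rr by (auto simp: rs_def)
  have "complex_of_real (\<Sum>i<n. B $$ (i, i)) = (\<Sum>i<n. ?C $$ (i, i))" using B by simp
  also have "\<dots> = complex_of_real (\<Sum>r\<leftarrow>rs. r)"
    unfolding trace_eq_sum_eigenvalues(1)[OF C es] es_rs by (induction rs) auto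
  finally have t1: "(\<Sum>i<n. B $$ (i, i)) = (\<Sum>r\<leftarrow>rs. r)" by (simp only: of_real_eq_iff)
  have "?C * ?C = map_mat complex_of_real (B * B)"
    by (rule of_real_hom.mat_hom_mult[OF B B, symmetric])
  hence "complex_of_real (\<Sum>i<n. (B * B) $$ (i, i)) = (\<Sum>i<n. (?C * ?C) $$ (i, i))" using B by simp
  also have "\<dots> = complex_of_real (\<Sum>r\<leftarrow>rs. r\<^sup>2)"
    unfolding trace_eq_sum_eigenvalues(2)[OF C es] es_rs by (induction rs) auto
  finally have t2: "(\<Sum>i<n. (B * B) $$ (i, i)) = (\<Sum>r\<leftarrow>rs. r\<^sup>2)" by (simp only: of_real_eq_iff)
  have "complex_of_real (Determinant.det (1\<^sub>m n - B)) = Determinant.det (map_mat complex_of_real (1\<^sub>m n - B))"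
    by (rule of_real_hom.hom_det[symmetric])
  \<comment> \<open>The determinant in question is the characteristic polynomial evaluated at
    1.\<close>
  also have "map_mat complex_of_real (1\<^sub>m n - B) = - (char_matrix ?C 1)"
    using B by (intro eq_matI) (auto simp: char_matrix_def)
  also have "Determinant.det \<dots> = poly (char_poly ?C) 1"
    by (rule char_poly_matrix[OF C, symmetric])
  also have "\<dots> = (\<Prod>e\<leftarrow>es. 1 - e)"
    unfolding es poly_prod_list by (simp add: o_def)
  also have "\<dots> = complex_of_real (\<Prod>r\<leftarrow>rs. 1 - r)"
    unfolding es_rs by (induction rs) auto
  finally have d: "Determinant.det (1\<^sub>m n - B) = (\<Prod>r\<leftarrow>rs. 1 - r)" by (simp only: of_real_eq_iff)
  have "exp (- (\<Sum>r\<leftarrow>rs. r) - (\<Sum>r\<leftarrow>rs. r\<^sup>2)) \<le> (\<Prod>r\<leftarrow>rs. 1 - r)" using rb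
  proof (induction rs)
    case (Cons r rs)
    have "exp (- r - r\<^sup>2) * exp (- (\<Sum>r\<leftarrow>rs. r) - (\<Sum>r\<leftarrow>rs. r\<^sup>2)) \<le> (1 - r) * (\<Prod>r\<leftarrow>rs. 1 - r)"
    proof (intro mult_mono)
      have r: "\<bar>r\<bar> \<le> 1 / 2" using Cons.prems by simp
      show "exp (- r - r\<^sup>2) \<le> 1 - r" by (rule exp_le_one_minus[OF r])
      show "0 \<le> 1 - r" using r by linarith
    qed (use Cons in auto)
    thus ?case by (simp add: exp_add[symmetric] algebra_simps)
  qed simp
  thus ?thesis unfolding d t1 t2 .
qed

text \<open>The cross terms between real and imaginary parts cancel by symmetry, so the Hermitian
  form is real.\<close>

lemma hermitian_form_of_symmetric:
  assumes A: "A \<in> sym_mats p"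
  shows "(\<Sum>i<p. \<Sum>j<p. cnj (v i) * complex_of_real (A $$ (i, j)) * v j) =
    complex_of_real (qform p A (\<lambda>i. Re (v i)) + qform p A (\<lambda>i. Im (v i)))"
proof (rule complex_eqI)
  show "Re (\<Sum>i<p. \<Sum>j<p. cnj (v i) * complex_of_real (A $$ (i, j)) * v j) =
    Re (complex_of_real (qform p A (\<lambda>i. Re (v i)) + qform p A (\<lambda>i. Im (v i))))"
    by (simp add: qform_def sum.distrib)
  have "(\<Sum>i<p. \<Sum>j<p. Re (v i) * A $$ (i, j) * Im (v j)) = (\<Sum>i<p. \<Sum>j<p. Im (v i) * A $$ (i, j) * Re (v j))"
    by (subst sum.swap) (intro sum.cong refl, simp add: sym_matsD(2)[OF A])
  thus "Im (\<Sum>i<p. \<Sum>j<p. cnj (v i) * complex_of_real (A $$ (i, j)) * v j) =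
    Im (complex_of_real (qform p A (\<lambda>i. Re (v i)) + qform p A (\<lambda>i. Im (v i))))"
    by (simp add: sum_subtractf sum.distrib sum_negf algebra_simps)
qed

text \<open>The product of two symmetric matrices need not be symmetric. But for an eigenvector
  \<open>x\<close> and \<open>w = S x\<close>, the number \<open>e\<close> times the positive form
  of \<open>S\<close> at \<open>x\<close> equals the Hermitian form of \<open>A\<close> at
  \<open>w\<close>, which is real. The norm bound comes from the eigenvalue equation at a coordinate
  of largest modulus.\<close>

lemma eigenvalue_sym_times_spd:
  assumes A: "A \<in> sym_mats p" and S: "S \<in> spd_mats p"
    and c: "abs_row_sums_le p (A * S) c"
    and e: "eigenvalue (map_mat complex_of_real (A * S)) e"
  shows "e \<in> \<real> \<and> norm e \<le> c"
proof -
  have Ac: "A \<in> carrier_mat p p" and Sc: "S \<in> carrier_mat p p"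
    using sym_matsD(1)[OF A] spd_matsD(1)[OF S] by auto
  let ?C = "map_mat complex_of_real (A * S)"
  obtain v where v: "v \<in> carrier_vec p" "v \<noteq> 0\<^sub>v p" "?C *\<^sub>v v = e \<cdot>\<^sub>v v"
    using e Ac by (auto simp: eigenvalue_def eigenvector_def)
  define x where "x i = v $ i" for i
  define w where "w i = (\<Sum>j<p. complex_of_real (S $$ (i, j)) * x j)" for i
  have ev: "(\<Sum>j<p. complex_of_real ((A * S) $$ (i, j)) * x j) = e * x i" if i: "i < p" for i
  proof -
    have "(?C *\<^sub>v v) $ i = (\<Sum>j<p. complex_of_real ((A * S) $$ (i, j)) * x j)"
      using i v(1) Ac Sc by (auto simp: scalar_prod_def lessThan_atLeast0 x_def)
    thus ?thesis using v i by (simp add: x_def)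
  qed
  obtain k0 where k0: "k0 < p" "x k0 \<noteq> 0"
    using v(1,2) unfolding x_def by (metis carrier_vecD eq_vecI index_zero_vec)
  have Aw: "(\<Sum>j<p. complex_of_real (A $$ (i, j)) * w j) = e * x i" if i: "i < p" for i
  proof -
    have "(\<Sum>j<p. complex_of_real (A $$ (i, j)) * w j) =
        (\<Sum>j<p. \<Sum>l<p. complex_of_real (A $$ (i, j) * S $$ (j, l)) * x l)"
      by (simp add: w_def sum_distrib_left mult.assoc)
    also have "\<dots> = (\<Sum>l<p. \<Sum>j<p. complex_of_real (A $$ (i, j) * S $$ (j, l)) * x l)"
      by (rule sum.swap)
    also have "\<dots> = (\<Sum>l<p. complex_of_real ((A * S) $$ (i, l)) * x l)"
      using i Ac Sc by (intro sum.cong refl) (auto simp: scalar_prod_def lessThan_atLeast0 sum_distrib_right)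
    finally show ?thesis using ev[OF i] by simp
  qed
  define h where "h = qform p S (\<lambda>i. Re (x i)) + qform p S (\<lambda>i. Im (x i))"
  have "Re (x k0) \<noteq> 0 \<or> Im (x k0) \<noteq> 0" using k0 by (auto simp: complex_eq_iff)
  hence h: "0 < h"
    unfolding h_def using spd_matsD(3)[OF S k0(1)] spd_mats_qform_nonneg[OF S]
    by (auto intro: add_pos_nonneg add_nonneg_pos)
  have H: "(\<Sum>i<p. cnj (x i) * w i) = complex_of_real h"
    unfolding h_def hermitian_form_of_symmetric[OF spd_imp_sym[OF S], symmetric] w_def
    by (simp add: sum_distrib_left mult.assoc)
  have "e * complex_of_real h = (\<Sum>i<p. cnj (w i) * (e * x i))"
  proof -
    have "complex_of_real h = cnj (\<Sum>i<p. cnj (x i) * w i)" unfolding H by simp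
    thus ?thesis by (simp add: sum_distrib_left mult_ac)
  qed
  also have "\<dots> = (\<Sum>i<p. \<Sum>j<p. cnj (w i) * complex_of_real (A $$ (i, j)) * w j)"
    by (intro sum.cong refl) (simp add: Aw[symmetric] sum_distrib_left mult.assoc)
  also have "\<dots> \<in> \<real>" unfolding hermitian_form_of_symmetric[OF A] by simp
  finally have "e * complex_of_real h / complex_of_real h \<in> \<real>" by (rule Reals_divide) simp
  hence "e \<in> \<real>" using h by simp
  moreover have "norm e \<le> c"
  proof -
    obtain i where i: "i < p" "\<And>j. j < p \<Longrightarrow> norm (x j) \<le> norm (x i)"
    proof -
      have f: "finite ((\<lambda>j. norm (x j)) ` {..<p})" "(\<lambda>j. norm (x j)) ` {..<p} \<noteq> {}" using k0 by auto
      obtain i where "i < p" "Max ((\<lambda>j. norm (x j)) ` {..<p}) = norm (x i)" using Max_in[OF f] by auto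
      moreover have "norm (x j) \<le> Max ((\<lambda>j. norm (x j)) ` {..<p})" if "j < p" for j
        using that by (intro Max_ge[OF f(1)]) auto
      ultimately show ?thesis using that by metis
    qed
    have xi: "0 < norm (x i)" using i(2)[OF k0(1)] k0(2) by (smt (verit) zero_less_norm_iff)
    have "norm e * norm (x i) = norm (\<Sum>j<p. complex_of_real ((A * S) $$ (i, j)) * x j)"
      using ev[OF i(1)] by (simp add: norm_mult)
    also have "\<dots> \<le> (\<Sum>j<p. \<bar>(A * S) $$ (i, j)\<bar> * norm (x i))"
      using i(2) by (intro order_trans[OF norm_sum] sum_mono) (auto simp: norm_mult intro!: mult_left_mono)
    also have "\<dots> = (\<Sum>j<p. \<bar>(A * S) $$ (i, j)\<bar>) * norm (x i)" by (simp add: sum_distrib_right)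
    also have "\<dots> \<le> c * norm (x i)"
      using c i(1) by (intro mult_right_mono) (auto simp: abs_row_sums_le_def)
    finally show ?thesis using xi by simp
  qed
  ultimately show ?thesis by simp
qed

section \<open>A Chernoff bound for quadratic forms of a Gaussian sample\<close>

lemma sets_gauss_vec [measurable_cong]: "sets (gauss_vec p S) = sets (Pi\<^sub>M {..<p} (\<lambda>_. lborel))"
  by (simp add: gauss_vec_def)

lemma phi_eq_sum:
  assumes "A \<in> carrier_mat p p" "B \<in> carrier_mat p p"
  shows "phi A B = (\<Sum>i<p. \<Sum>j<p. A $$ (i, j) * B $$ (j, i))"
  using assms by (auto simp: phi_def mat_trace_def scalar_prod_def lessThan_atLeast0 intro!: sum.cong)

lemma phi_minus:
  assumes "A \<in> carrier_mat p p" "B \<in> carrier_mat p p" "C \<in> carrier_mat p p"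
  shows "phi A (B - C) = phi A B - phi A C"
  unfolding phi_eq_sum[OF assms(1,2)] phi_eq_sum[OF assms(1,3)]
    phi_eq_sum[OF assms(1) minus_carrier_mat[OF assms(3)]]
  using assms by (simp add: sum_subtractf[symmetric] right_diff_distrib)

lemma sample_cov_carrier [simp]: "sample_cov n p X \<in> carrier_mat p p"
  by (simp add: sample_cov_def)

text \<open>Displays the statistic as an average of independent quadratic forms, so that its
  exponential moment factorises.\<close>

lemma phi_sample_cov:
  assumes "A \<in> carrier_mat p p"
  shows "phi A (sample_cov n p X) = (\<Sum>k=1..n. qform p A (X k)) / real n"
proof -
  have "phi A (sample_cov n p X) = (\<Sum>i<p. \<Sum>j<p. \<Sum>k=1..n. X k i * A $$ (i, j) * X k j / real n)"
    unfolding phi_eq_sum[OF assms sample_cov_carrier]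
    by (intro sum.cong refl) (simp add: sample_cov_def sum_distrib_left sum_divide_distrib mult_ac)
  also have "\<dots> = (\<Sum>k=1..n. \<Sum>i<p. \<Sum>j<p. X k i * A $$ (i, j) * X k j / real n)"
    by (subst sum.swap[of _ _ "{1..n}"], subst sum.swap[of _ "{1..n}"]) (simp add: sum.swap[of _ _ "{1..n}"])
  also have "\<dots> = (\<Sum>k=1..n. qform p A (X k)) / real n"
    by (simp add: qform_def sum_divide_distrib)
  finally show ?thesis .
qed

lemma measurable_phi_sample_cov:
  assumes "A \<in> carrier_mat p p"
  shows "(\<lambda>X. phi A (sample_cov n p X)) \<in> borel_measurable (gauss_sample n p S)"
  unfolding phi_sample_cov[OF assms] gauss_sample_def by measurable

lemma prob_space_gauss_sample:
  "S \<in> spd_mats p \<Longrightarrow> prob_space (gauss_sample n p S)"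
  unfolding gauss_sample_def by (intro prob_space_PiM prob_space_gauss_vec)

lemma qform_smult:
  "A \<in> carrier_mat p p \<Longrightarrow> qform p (c \<cdot>\<^sub>m A) x = c * qform p A x"
  by (simp add: qform_def sum_distrib_left mult_ac)

text \<open>The row sums of \<open>A * S\<close> are at most \<open>a * b\<close>, so
  \<open>a * b \<le> 1 / 2\<close> confines the eigenvalues to the range where the determinant bound
  holds.\<close>

lemma gauss_vec_mgf_le:
  assumes S: "S \<in> spd_mats p" and A: "A \<in> sym_mats p"
    and a: "abs_row_sums_le p A a" "0 \<le> a" and b: "abs_row_sums_le p S b" "0 < b" and ab: "a * b \<le> 1 / 2"
  shows "(\<integral>\<^sup>+x. ennreal (exp (qform p A x / 2)) \<partial>gauss_vec p S) \<le>
    ennreal (exp ((mat_trace (A * S) + mat_trace (A * S * (A * S))) / 2))"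
proof -
  have Ac: "A \<in> carrier_mat p p" and Sc: "S \<in> carrier_mat p p"
    using sym_matsD(1)[OF A] spd_matsD(1)[OF S] by auto
  have ab1: "a * b < 1" using ab by simp
  let ?D = "Determinant.det (1\<^sub>m p - A * S)"
  let ?t = "mat_trace (A * S) + mat_trace (A * S * (A * S))"
  have r: "abs_row_sums_le p (A * S) (1 / 2)"
    using abs_row_sums_le_mult[OF Ac Sc a(1) b(1)] ab b(2) unfolding abs_row_sums_le_def by fastforce
  have "exp (- ?t) \<le> ?D"
    using det_one_minus_ge_exp_trace[OF mult_carrier_mat[OF Ac Sc] eigenvalue_sym_times_spd[OF A S r]] Ac
    by (simp add: mat_trace_def)
  moreover have "(exp (- ?t / 2))\<^sup>2 = exp (- ?t)"
    unfolding exp_double[symmetric] by (rule arg_cong[of _ _ exp]) simp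
  ultimately have "exp (- ?t / 2) \<le> sqrt ?D"
    by (intro real_le_rsqrt) simp
  hence "1 / sqrt ?D \<le> 1 / exp (- ?t / 2)"
    using gauss_vec_mgf(1)[OF S A a(1) b ab1 a(2)] by (intro divide_left_mono mult_pos_pos) auto
  also have "\<dots> = exp (?t / 2)" unfolding minus_divide_left[symmetric] exp_minus by (simp add: inverse_eq_divide)
  finally show ?thesis
    unfolding gauss_vec_mgf(2)[OF S A a(1) b ab1 a(2)] by (rule ennreal_leI)
qed

text \<open>Exponential Markov inequality with parameter \<open>t\<close>. Independence gives the
  \<open>n\<close>-th power of the single-vector moment, its first-order trace term cancels the
  centring \<open>phi A S\<close>, and only the second-order term with \<open>V\<close>
  survives.\<close>

lemma gauss_sample_chernoff:
  assumes S: "S \<in> spd_mats p" and A: "A \<in> sym_mats p" and n: "1 \<le> n"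
    and a: "abs_row_sums_le p A a" "0 \<le> a" and b: "abs_row_sums_le p S b" "0 < b"
    and V: "mat_trace (A * S * (A * S)) \<le> V"
    and t: "0 \<le> t" "4 * t * (a * b) \<le> real n"
  shows "measure (gauss_sample n p S)
      {X \<in> space (gauss_sample n p S). d \<le> phi A (sample_cov n p X) - phi A S}
    \<le> exp (- t * d + 2 * t\<^sup>2 * V / real n)"
proof -
  have Ac: "A \<in> carrier_mat p p" and Sc: "S \<in> carrier_mat p p"
    using sym_matsD(1)[OF A] spd_matsD(1)[OF S] by auto
  note [measurable] = measurable_phi_sample_cov[OF Ac]
  let ?M = "gauss_sample n p S"
  let ?E = "{X \<in> space ?M. d \<le> phi A (sample_cov n p X) - phi A S}"
  interpret prob_space ?M using S by (rule prob_space_gauss_sample)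
  interpret G: product_sigma_finite "\<lambda>_::nat. gauss_vec p S"
    using prob_space_gauss_vec[OF S] by (intro product_sigma_finite.intro prob_space_imp_sigma_finite)
  \<comment> \<open>This scaling gives \<open>qform p B x / 2 = t / n * qform p A x\<close>, and the
    constraint on \<open>t\<close> becomes \<open>c * a * b \<le> 1 / 2\<close>.\<close>
  define c where "c = 2 * t / real n"
  define B where "B = c \<cdot>\<^sub>m A"
  have c: "0 \<le> c" using t by (simp add: c_def)
  have Bs: "B \<in> sym_mats p"
    using A Ac by (auto simp: B_def sym_mats_def)
  have Br: "abs_row_sums_le p B (c * a)"
    using a(1) Ac c unfolding abs_row_sums_le_def B_def
    by (auto simp: abs_mult sum_distrib_left[symmetric] intro!: mult_left_mono)
  have cab: "c * a * b \<le> 1 / 2" using t(2) n by (simp add: c_def field_simps)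
  have AS: "A * S \<in> carrier_mat p p" using Ac Sc by simp
  have BS: "B * S = c \<cdot>\<^sub>m (A * S)" using Ac Sc by (simp add: B_def mult_smult_assoc_mat)
  have tr1: "mat_trace (B * S) = c * phi A S"
    unfolding BS using Ac Sc by (simp add: mat_trace_def phi_def sum_distrib_left)
  have "B * S * (B * S) = c \<cdot>\<^sub>m (c \<cdot>\<^sub>m (A * S * (A * S)))"
    using mult_smult_assoc_mat[OF AS smult_carrier_mat[OF AS, of c], of c] mult_smult_distrib[OF AS AS, of c]
    unfolding BS by simp
  hence tr2: "mat_trace (B * S * (B * S)) = c\<^sup>2 * mat_trace (A * S * (A * S))"
    using Ac Sc by (simp add: mat_trace_def sum_distrib_left power2_eq_square mult.assoc)
  have qB: "qform p B x / 2 = t / real n * qform p A x" for x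
    by (simp add: B_def qform_smult[OF Ac] c_def)
  have mg: "(\<integral>\<^sup>+x. ennreal (exp (t / real n * qform p A x)) \<partial>gauss_vec p S) \<le>
      ennreal (exp (c / 2 * phi A S + c\<^sup>2 / 2 * V))"
  proof -
    have "(\<integral>\<^sup>+x. ennreal (exp (t / real n * qform p A x)) \<partial>gauss_vec p S) \<le>
      ennreal (exp ((c * phi A S + c\<^sup>2 * mat_trace (A * S * (A * S))) / 2))"
      using gauss_vec_mgf_le[OF S Bs Br mult_nonneg_nonneg[OF c a(2)] b cab] unfolding tr1 tr2 qB .
    also have "\<dots> \<le> ennreal (exp (c / 2 * phi A S + c\<^sup>2 / 2 * V))"
      using mult_left_mono[OF V zero_le_power2[of c]] by (intro ennreal_leI) (simp add: field_simps)
    finally show ?thesis .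
  qed
  have "emeasure ?M ?E = (\<integral>\<^sup>+X. indicator ?E X \<partial>?M)"
    by (rule nn_integral_indicator[symmetric]) measurable
  also have "\<dots> \<le> (\<integral>\<^sup>+X. ennreal (exp (- t * (phi A S + d))) * (\<Prod>k\<in>{1..n}. ennreal (exp (t / real n * qform p A (X k)))) \<partial>?M)"
  proof (rule nn_integral_mono)
    fix X assume "X \<in> space ?M"
    have pr: "(\<Prod>k\<in>{1..n}. ennreal (exp (t / real n * qform p A (X k)))) = ennreal (exp (t * phi A (sample_cov n p X)))"
      by (simp add: prod_ennreal exp_sum[symmetric] phi_sample_cov[OF Ac] sum_distrib_left sum_divide_distrib)
    have "1 \<le> exp (t * (phi A (sample_cov n p X) - phi A S - d))" if "X \<in> ?E"
      using that t by simp
    hence "indicator ?E X \<le> ennreal (exp (t * (phi A (sample_cov n p X) - phi A S - d)))"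
      by (auto simp: indicator_def simp flip: ennreal_1 intro!: ennreal_leI)
    also have "\<dots> = ennreal (exp (- t * (phi A S + d))) * ennreal (exp (t * phi A (sample_cov n p X)))"
      by (simp add: ennreal_mult[symmetric] exp_add[symmetric] algebra_simps)
    finally show "indicator ?E X \<le> ennreal (exp (- t * (phi A S + d))) * (\<Prod>k\<in>{1..n}. ennreal (exp (t / real n * qform p A (X k))))"
      unfolding pr .
  qed
  also have "\<dots> = ennreal (exp (- t * (phi A S + d))) * (\<integral>\<^sup>+X. (\<Prod>k\<in>{1..n}. ennreal (exp (t / real n * qform p A (X k)))) \<partial>?M)"
    by (rule nn_integral_cmult) (unfold gauss_sample_def, measurable)
  also have "(\<integral>\<^sup>+X. (\<Prod>k\<in>{1..n}. ennreal (exp (t / real n * qform p A (X k)))) \<partial>?M) =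
      (\<Prod>k\<in>{1..n}. \<integral>\<^sup>+x. ennreal (exp (t / real n * qform p A x)) \<partial>gauss_vec p S)"
    unfolding gauss_sample_def by (rule G.product_nn_integral_prod) (auto, measurable)
  also have "\<dots> \<le> (\<Prod>k\<in>{1..n}. ennreal (exp (c / 2 * phi A S + c\<^sup>2 / 2 * V)))"
    by (intro prod_mono_ennreal mg)
  also have "\<dots> = ennreal (exp (real n * (c / 2 * phi A S + c\<^sup>2 / 2 * V)))"
    by (simp add: ennreal_power exp_of_nat_mult)
  also have "real n * (c / 2 * phi A S + c\<^sup>2 / 2 * V) = t * phi A S + 2 * t\<^sup>2 * V / real n"
    using n by (simp add: c_def field_simps power2_eq_square)
  also have "ennreal (exp (- t * (phi A S + d))) * ennreal (exp (t * phi A S + 2 * t\<^sup>2 * V / real n)) =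
      ennreal (exp (- t * d + 2 * t\<^sup>2 * V / real n))"
    by (simp add: ennreal_mult[symmetric] exp_add[symmetric] algebra_simps)
  finally have "emeasure ?M ?E \<le> ennreal (exp (- t * d + 2 * t\<^sup>2 * V / real n))"
    by (simp add: mult_left_mono)
  thus ?thesis by (simp add: emeasure_eq_measure)
qed

text \<open>With \<open>K = a * b / n\<close> the exponent to minimise is
  \<open>- t * d + t\<^sup>2 * K\<close> subject to \<open>t \<le> 1 / (4 * K)\<close>. The two
  terms of the maximum serve the cases of an interior and a boundary minimiser.\<close>

lemma gauss_sample_tail:
  assumes S: "S \<in> spd_mats p" and A: "A \<in> sym_mats p" and n: "1 \<le> n"
    and a: "abs_row_sums_le p A a" "0 < a" and b: "abs_row_sums_le p S b" "0 < b"
    and V: "mat_trace (A * S * (A * S)) \<le> a * b / 2"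
    and d: "max (sqrt (4 * x * (a * b) / real n)) (8 * x * (a * b) / real n) \<le> d" and x: "0 \<le> x"
  shows "measure (gauss_sample n p S)
      {X \<in> space (gauss_sample n p S). d \<le> phi A (sample_cov n p X) - phi A S} \<le> exp (- x)"
proof -
  define K where "K = a * b / real n"
  have K: "0 < K" using a b n by (simp add: K_def)
  have nK: "a * b = real n * K" using n by (simp add: K_def)
  have d1: "sqrt (4 * x * K) \<le> d" and d2: "8 * x * K \<le> d"
    using d by (auto simp: K_def)
  have d0: "0 \<le> d" using d1 x K by (meson mult_nonneg_nonneg order_trans real_sqrt_ge_zero less_imp_le zero_le_numeral)
  have dd: "4 * x * K \<le> d\<^sup>2" using d1 d0 by (simp add: real_sqrt_le_iff sqrt_le_D)
  have "\<exists>t\<ge>0. 4 * t * (a * b) \<le> real n \<and> - t * d + 2 * t\<^sup>2 * (a * b / 2) / real n \<le> - x"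
  proof (cases "d \<le> 1 / 2")
    case True
    show ?thesis
    \<comment> \<open>The unconstrained minimiser, admissible because \<open>d \<le> 1 / 2\<close>;
      the value is \<open>- d\<^sup>2 / (4 * K)\<close>.\<close>
    proof (intro exI[of _ "d / (2 * K)"] conjI)
      show "4 * (d / (2 * K)) * (a * b) \<le> real n"
        unfolding nK using K mult_right_mono[OF True, of "2 * real n"] by (simp add: field_simps)
      have "- (d / (2 * K)) * d + 2 * (d / (2 * K))\<^sup>2 * (a * b / 2) / real n = - d\<^sup>2 / (4 * K)"
        unfolding nK using K n by (simp add: field_simps power2_eq_square)
      also have "\<dots> \<le> - x" using dd K by (simp add: field_simps)
      finally show "- (d / (2 * K)) * d + 2 * (d / (2 * K))\<^sup>2 * (a * b / 2) / real n \<le> - x" .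
    qed (use d0 K in simp)
  next
    case False
    show ?thesis
    \<comment> \<open>The largest admissible parameter. Since \<open>d > 1 / 2\<close>, at least
      half of the linear term remains, which gives \<open>- d / (8 * K)\<close>.\<close>
    proof (intro exI[of _ "1 / (4 * K)"] conjI)
      show "4 * (1 / (4 * K)) * (a * b) \<le> real n" unfolding nK using K by simp
      have "- (1 / (4 * K)) * d + 2 * (1 / (4 * K))\<^sup>2 * (a * b / 2) / real n = (1 / 4 - d) / (4 * K)"
        unfolding nK using K n by (simp add: field_simps power2_eq_square)
      also have "\<dots> \<le> (- d / 2) / (4 * K)" using False K by (intro divide_right_mono) auto
      also have "\<dots> \<le> - x" using d2 K by (simp add: field_simps)
      finally show "- (1 / (4 * K)) * d + 2 * (1 / (4 * K))\<^sup>2 * (a * b / 2) / real n \<le> - x" .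
    qed (use K in simp)
  qed
  then obtain t where t: "0 \<le> t" "4 * t * (a * b) \<le> real n"
    "- t * d + 2 * t\<^sup>2 * (a * b / 2) / real n \<le> - x" by blast
  show ?thesis
    using gauss_sample_chernoff[OF S A n a(1) less_imp_le[OF a(2)] b V t(1,2), of d] t(3)
    by (meson exp_le_cancel_iff order_trans)
qed

text \<open>With a trace bound twice as large the exponent is
  \<open>- t * d + 2 * t\<^sup>2 * K\<close>. Its minimiser \<open>d / (4 * K)\<close> is admissible
  exactly for \<open>d \<le> 1\<close>, so a single regime suffices.\<close>

lemma gauss_sample_tail_small:
  assumes S: "S \<in> spd_mats p" and A: "A \<in> sym_mats p" and n: "1 \<le> n"
    and a: "abs_row_sums_le p A a" "0 < a" and b: "abs_row_sums_le p S b" "0 < b"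
    and V: "mat_trace (A * S * (A * S)) \<le> a * b"
    and d: "8 * x * (a * b) / real n \<le> d\<^sup>2" "0 \<le> d" "d \<le> 1"
  shows "measure (gauss_sample n p S)
      {X \<in> space (gauss_sample n p S). d \<le> phi A (sample_cov n p X) - phi A S} \<le> exp (- x)"
proof -
  define K where "K = a * b / real n"
  have K: "0 < K" using a b n by (simp add: K_def)
  have nK: "a * b = real n * K" using n by (simp add: K_def)
  have t: "0 \<le> d / (4 * K)" "4 * (d / (4 * K)) * (a * b) \<le> real n"
    unfolding nK using K d n by (auto simp: mult_left_le_one_le)
  have "- (d / (4 * K)) * d + 2 * (d / (4 * K))\<^sup>2 * (a * b) / real n = - d\<^sup>2 / (8 * K)"
    unfolding nK using K n by (simp add: field_simps power2_eq_square)
  also have "\<dots> \<le> - x"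
  proof -
    have "8 * x * K \<le> d\<^sup>2" using d(1) unfolding K_def by simp
    thus ?thesis using K by (simp add: field_simps)
  qed
  finally have "- (d / (4 * K)) * d + 2 * (d / (4 * K))\<^sup>2 * (a * b) / real n \<le> - x" .
  thus ?thesis
    using gauss_sample_chernoff[OF S A n a(1) less_imp_le[OF a(2)] b V t, of d]
    by (meson exp_le_cancel_iff order_trans)
qed

section \<open>Band and Toeplitz matrices\<close>

definition band :: "nat \<Rightarrow> nat \<Rightarrow> nat \<Rightarrow> real" where
  "band j k l = (if \<bar>int k - int l\<bar> = int j then 1 else 0)"

lemma band_simps:
  "0 \<le> band j k l" "band j k l \<le> 1" "\<bar>band j k l\<bar> = band j k l" "band j k l = band j l k"
  "band j k l * band j k l = band j k l"
  by (auto simp: band_def)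

lemma band_split:
  "1 \<le> j \<Longrightarrow> band j k l = (if l = k + j then 1 else 0) + (if k = l + j then 1 else 0)"
  by (auto simp: band_def)

lemma sum_band_row_le:
  assumes "1 \<le> j"
  shows "(\<Sum>l<p. band j k l) \<le> 2"
proof -
  \<comment> \<open>The guard \<open>j \<le> k\<close> is needed because \<open>k - j\<close> is
    truncated subtraction.\<close>
  have "(\<Sum>l<p. if k = l + j then 1 else 0 :: real) = (\<Sum>l<p. if l = k - j then (if j \<le> k then 1 else 0) else 0)"
    by (intro sum.cong) auto
  hence "(\<Sum>l<p. if k = l + j then 1 else 0 :: real) \<le> 1" by simp
  moreover have "(\<Sum>l<p. if l = k + j then 1 else 0 :: real) \<le> 1" by simp
  ultimately show ?thesis by (simp add: band_split[OF assms] sum.distrib)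
qed

lemma sum_band:
  assumes "1 \<le> j" "j < p"
  shows "(\<Sum>k<p. \<Sum>l<p. band j k l) = 2 * (real p - real j)"
proof -
  have e: "(\<Sum>k<p. \<Sum>l<p. if l = k + j then 1 else 0 :: real) = real p - real j"
  proof -
    have "(\<Sum>k<p. \<Sum>l<p. if l = k + j then 1 else 0 :: real) = (\<Sum>k<p. if k < p - j then 1 else 0)"
      by (intro sum.cong) auto
    also have "\<dots> = real (card ({..<p} \<inter> {k. k < p - j}))" by (simp add: sum.If_cases)
    also have "{..<p} \<inter> {k. k < p - j} = {..<p - j}" by auto
    finally show ?thesis using assms by (simp add: of_nat_diff)
  qed
  have "(\<Sum>k<p. \<Sum>l<p. if k = l + j then 1 else 0 :: real) = real p - real j"
    by (subst sum.swap) (rule e)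
  thus ?thesis using e by (simp add: band_split[OF assms(1)] sum.distrib)
qed

lemma diag_mat_A_index:
  "k < p \<Longrightarrow> l < p \<Longrightarrow> diag_mat_A p j $$ (k, l) = band j k l / (2 * (real p - real j))"
  by (simp add: diag_mat_A_def band_def)

lemma diag_mat_A_carrier [simp]: "diag_mat_A p j \<in> carrier_mat p p"
  by (simp add: diag_mat_A_def)

text \<open>The two diagonals at distance \<open>j\<close> have \<open>p - j\<close> entries each,
  which the normalisation compensates; hence \<open>phi\<close> with this matrix averages over
  them.\<close>

lemma sum_diag_mat_A:
  assumes "1 \<le> j" "j < p"
  shows "(\<Sum>k<p. \<Sum>l<p. diag_mat_A p j $$ (k, l)) = 1"
proof -
  have "(\<Sum>k<p. \<Sum>l<p. diag_mat_A p j $$ (k, l)) = (\<Sum>k<p. \<Sum>l<p. band j k l) / (2 * (real p - real j))"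
    unfolding sum_divide_distrib by (intro sum.cong refl) (simp add: diag_mat_A_index)
  also have "\<dots> = 1" using assms by (simp add: sum_band)
  finally show ?thesis .
qed

text \<open>A row meets the band at most twice. Replacing \<open>p - j\<close> by
  \<open>p - S\<close> makes the bound uniform over \<open>j \<le> S\<close>.\<close>

lemma diag_mat_A_row_sums:
  assumes "1 \<le> j" "j \<le> S" "S < p" "k < p"
  shows "(\<Sum>l<p. \<bar>diag_mat_A p j $$ (k, l)\<bar>) \<le> 1 / (real p - real S)"
proof -
  have "(\<Sum>l<p. \<bar>diag_mat_A p j $$ (k, l)\<bar>) = (\<Sum>l<p. band j k l) / (2 * (real p - real j))"
    unfolding sum_divide_distrib using assms
    by (intro sum.cong refl) (simp add: diag_mat_A_index abs_divide band_simps(3))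
  also have "\<dots> \<le> 2 / (2 * (real p - real j))"
    using sum_band_row_le[OF assms(1)] assms by (intro divide_right_mono) auto
  also have "\<dots> = 1 / (real p - real j)" by (rule frac_eq_eq[THEN iffD2]) (use assms in auto)
  also have "\<dots> \<le> 1 / (real p - real S)"
    using assms by (intro divide_left_mono mult_pos_pos) auto
  finally show ?thesis .
qed

lemma phi_diag_mat_A_toeplitz:
  assumes "1 \<le> j" "j < p" and M: "M \<in> carrier_mat p p"
    and c: "\<And>k l. k < p \<Longrightarrow> l < p \<Longrightarrow> \<bar>int k - int l\<bar> = int j \<Longrightarrow> M $$ (k, l) = c"
  shows "phi (diag_mat_A p j) M = c"
proof -
  have "phi (diag_mat_A p j) M = (\<Sum>k<p. \<Sum>l<p. diag_mat_A p j $$ (k, l) * c)"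
    unfolding phi_eq_sum[OF diag_mat_A_carrier M]
    by (intro sum.cong refl) (auto simp: diag_mat_A_index band_def c abs_minus_commute)
  also have "\<dots> = (\<Sum>k<p. \<Sum>l<p. diag_mat_A p j $$ (k, l)) * c"
    by (simp add: sum_distrib_right)
  finally show ?thesis using sum_diag_mat_A[OF assms(1,2)] by simp
qed

lemma phi_diag_mat_A_one: "1 \<le> j \<Longrightarrow> j < p \<Longrightarrow> phi (diag_mat_A p j) (1\<^sub>m p) = 0"
  by (rule phi_diag_mat_A_toeplitz) auto

section \<open>Toeplitz coefficients under positive definiteness and sparsity\<close>

lemma qform_support:
  assumes "I \<subseteq> {..<p}" "\<And>i. i \<notin> I \<Longrightarrow> x i = 0"
  shows "qform p Q x = (\<Sum>i\<in>I. \<Sum>j\<in>I. x i * Q $$ (i, j) * x j)"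
proof -
  have "qform p Q x = (\<Sum>i\<in>I. \<Sum>j<p. x i * Q $$ (i, j) * x j)"
    unfolding qform_def by (rule sum.mono_neutral_right) (use assms in auto)
  also have "\<dots> = (\<Sum>i\<in>I. \<Sum>j\<in>I. x i * Q $$ (i, j) * x j)"
    by (intro sum.cong refl sum.mono_neutral_right) (use assms in auto)
  finally show ?thesis .
qed

lemma one_mat_spd: "1\<^sub>m p \<in> spd_mats p"
proof -
  have q: "qform p (1\<^sub>m p) x = (\<Sum>i<p. (x i)\<^sup>2)" for x
    by (simp add: qform_eq_mv mv_one power2_eq_square)
  have "0 < qform p (1\<^sub>m p) x" if x: "\<exists>i<p. x i \<noteq> 0" for x
  proof -
    obtain i where "i < p" "x i \<noteq> 0" using x by blast
    thus ?thesis unfolding q by (intro sum_pos2[of _ i]) auto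
  qed
  thus ?thesis unfolding spd_mats_iff by auto
qed

lemma toeplitz_spd_index:
  assumes "M \<in> spd_mats p" "M \<in> toeplitz_mats p" "i < p" "j < p"
  shows "M $$ (i, j) = toep_coeff M (nat \<bar>int i - int j\<bar>)"
proof -
  obtain t where t: "\<And>i j. i < p \<Longrightarrow> j < p \<Longrightarrow> M $$ (i, j) = t (int i - int j)"
    using assms(2) unfolding toeplitz_mats_def by blast
  have le: "M $$ (i, j) = toep_coeff M (nat \<bar>int i - int j\<bar>)" if "i \<le> j" "i < p" "j < p" for i j
  proof -
    have "M $$ (i, j) = t (int i - int j)" using t that by blast
    moreover have "M $$ (0, j - i) = t (int 0 - int (j - i))" using t that by (intro t) auto
    ultimately show ?thesis using that by (simp add: toep_coeff_def of_nat_diff nat_diff_distrib)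
  qed
  show ?thesis
  proof (cases "i \<le> j")
    case True thus ?thesis using le assms by blast
  next
    case False
    thus ?thesis using le[of j i] spd_matsD(2)[OF assms(1) assms(3,4)] assms by (simp add: abs_minus_commute)
  qed
qed

lemma toep_coeff_abs_less_1:
  assumes "M \<in> spd_mats p" "M \<in> toeplitz_mats p" "toep_coeff M 0 = 1" "1 \<le> j" "j < p"
  shows "\<bar>toep_coeff M j\<bar> < 1"
proof -
  have m: "M $$ (0, 0) = 1" "M $$ (j, j) = 1" "M $$ (0, j) = toep_coeff M j" "M $$ (j, 0) = toep_coeff M j"
    using toeplitz_spd_index[OF assms(1,2), of 0 0] toeplitz_spd_index[OF assms(1,2), of j j]
      toeplitz_spd_index[OF assms(1,2), of 0 j] toeplitz_spd_index[OF assms(1,2), of j 0] assms by auto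
  have "0 < 2 + 2 * c * toep_coeff M j" if "c * c = 1" for c :: real
  proof -
    \<comment> \<open>The vectors with entries 1 and \<open>c = \<plusminus>1\<close> at positions 0
      and \<open>j\<close> give both signs of the bound.\<close>
    let ?x = "\<lambda>i. if i = 0 then 1 else if i = j then c else 0"
    have "0 < qform p M ?x" by (rule spd_matsD(3)[OF assms(1), of 0]) (use assms in auto)
    also have "qform p M ?x = (\<Sum>i\<in>{0, j}. \<Sum>l\<in>{0, j}. ?x i * M $$ (i, l) * ?x l)"
      using assms by (intro qform_support) auto
    also have "\<dots> = 1 + c * c + 2 * c * toep_coeff M j" using assms(4) by (simp add: m algebra_simps)
    finally show ?thesis using that by simp
  qed
  from this[of 1] this[of "-1"] show ?thesis by simp
qed

lemma toep_coeff_squared_less_half: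
  assumes "M \<in> spd_mats p" "M \<in> toeplitz_mats p" "toep_coeff M 0 = 1" "1 \<le> j" "2 * j < p"
    and z: "toep_coeff M (2 * j) = 0"
  shows "(toep_coeff M j)\<^sup>2 < 1 / 2"
proof -
  define k where "k = 2 * j"
  let ?r = "toep_coeff M j"
  note ix = toeplitz_spd_index[OF assms(1,2)]
  have ne: "j \<noteq> 0" "k \<noteq> 0" "j \<noteq> k" "k \<noteq> j" "j < p" "k < p" "0 < p" using assms by (auto simp: k_def)
  have m: "M $$ (0, 0) = 1" "M $$ (j, j) = 1" "M $$ (k, k) = 1"
    "M $$ (0, j) = ?r" "M $$ (j, 0) = ?r" "M $$ (j, k) = ?r" "M $$ (k, j) = ?r"
    "M $$ (0, k) = 0" "M $$ (k, 0) = 0"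
    using ix[of 0 0] ix[of j j] ix[of k k] ix[of 0 j] ix[of j 0] ix[of j k]
      ix[of k j] ix[of 0 k] ix[of k 0] assms by (auto simp: k_def nat_mult_distrib)
  \<comment> \<open>With entries 1, \<open>y\<close>, 1 at positions 0, \<open>j\<close>,
    \<open>2 * j\<close> the form is \<open>2 + 4 * ?r * y + y\<^sup>2\<close>, smallest at
    \<open>y = - 2 * ?r\<close>.\<close>
  let ?x = "\<lambda>i. if i = j then - 2 * ?r else if i = 0 \<or> i = k then 1 else 0"
  have "0 < qform p M ?x" by (rule spd_matsD(3)[OF assms(1), of 0]) (use ne in auto)
  also have "qform p M ?x = (\<Sum>i\<in>{0, j, k}. \<Sum>l\<in>{0, j, k}. ?x i * M $$ (i, l) * ?x l)"
    using ne by (intro qform_support) auto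
  also have "\<dots> = 2 - 4 * ?r\<^sup>2" using ne by (simp add: m algebra_simps power2_eq_square)
  finally show ?thesis by simp
qed

lemma sparse_toeplitz_classE:
  assumes M: "M \<in> sparse_toeplitz_class p s S \<sigma>" and "S < p"
  obtains J where "J \<subseteq> {1..S}" "card J = s" "finite J"
    "\<And>j. j \<in> J \<Longrightarrow> \<sigma> \<le> \<bar>toep_coeff M j\<bar>"
    "\<And>j. 1 \<le> j \<Longrightarrow> j < p \<Longrightarrow> j \<notin> J \<Longrightarrow> toep_coeff M j = 0"
    "M \<in> spd_mats p" "M \<in> toeplitz_mats p" "toep_coeff M 0 = 1"
proof -
  from M obtain J where J: "J \<subseteq> {1..S}" "card J = s" "\<forall>j\<in>J. \<sigma> \<le> \<bar>toep_coeff M j\<bar>"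
    "\<forall>j\<in>{1..p - 1} - J. toep_coeff M j = 0" and
    m: "M \<in> spd_mats p" "M \<in> toeplitz_mats p" "toep_coeff M 0 = 1"
    unfolding sparse_toeplitz_class_def by blast
  have "toep_coeff M j = 0" if "1 \<le> j" "j < p" "j \<notin> J" for j
    using J(4) that by auto
  moreover have "finite J" using J(1) finite_subset by blast
  ultimately show ?thesis using that J(1-3) m by blast
qed

lemma toep_coeff_abs_le_1:
  assumes "M \<in> spd_mats p" "M \<in> toeplitz_mats p" "toep_coeff M 0 = 1" "j < p"
  shows "\<bar>toep_coeff M j\<bar> \<le> 1"
  using toep_coeff_abs_less_1[OF assms(1-3), of j] assms by (cases "j = 0") auto

text \<open>All entries are at most 1 in absolute value; a row has one diagonal entry and at most
  two entries at each distance in \<open>J\<close>.\<close>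

lemma sparse_toeplitz_row_sums:
  assumes J: "finite J" "J \<subseteq> {1..S}"
    and z: "\<And>j. 1 \<le> j \<Longrightarrow> j < p \<Longrightarrow> j \<notin> J \<Longrightarrow> toep_coeff M j = 0"
    and M: "M \<in> spd_mats p" "M \<in> toeplitz_mats p" "toep_coeff M 0 = 1"
  shows "abs_row_sums_le p M (2 * real (card J) + 1)"
  unfolding abs_row_sums_le_def
proof (intro allI impI)
  fix k assume k: "k < p"
  have "(\<Sum>l<p. \<bar>M $$ (k, l)\<bar>) \<le> (\<Sum>l<p. (if l = k then 1 else 0) + (\<Sum>j\<in>J. band j k l))"
  proof (rule sum_mono)
    fix l assume l: "l \<in> {..<p}"
    let ?d = "nat \<bar>int k - int l\<bar>"
    have e: "M $$ (k, l) = toep_coeff M ?d" using toeplitz_spd_index[OF M(1,2)] k l by simp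
    have dp: "?d < p" using k l by auto
    have b1: "\<bar>M $$ (k, l)\<bar> \<le> 1" unfolding e by (rule toep_coeff_abs_le_1[OF M dp])
    have nn: "0 \<le> (\<Sum>j\<in>J. band j k l)" by (intro sum_nonneg band_simps(1))
    show "\<bar>M $$ (k, l)\<bar> \<le> (if l = k then 1 else 0) + (\<Sum>j\<in>J. band j k l)"
    proof (cases "l = k")
      case True thus ?thesis using b1 nn by simp
    next
      case False
      show ?thesis
      proof (cases "?d \<in> J")
        case True
        have "1 = band ?d k l" by (simp add: band_def)
        also have "\<dots> \<le> (\<Sum>j\<in>J. band j k l)"
          by (rule member_le_sum[OF True]) (auto simp: band_simps(1) J(1))
        finally show ?thesis using b1 False by simp
      next
        case F: False
        have "toep_coeff M ?d = 0" using z[of ?d] dp F False by auto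
        thus ?thesis using e nn False by simp
      qed
    qed
  qed
  also have "\<dots> = 1 + (\<Sum>j\<in>J. \<Sum>l<p. band j k l)"
    using k by (simp add: sum.distrib sum.swap[of _ J])
  also have "\<dots> \<le> 1 + (\<Sum>j\<in>J. 2)"
    using J(2) by (intro add_left_mono sum_mono sum_band_row_le) auto
  finally show "(\<Sum>l<p. \<bar>M $$ (k, l)\<bar>) \<le> 2 * real (card J) + 1" by simp
qed

text \<open>Covers both uses: a singleton with weight 1 or -1 under the null hypothesis, and a
  signed average over the support under an alternative. Weights of absolute sum at most 1 preserve
  the bounds of a single band.\<close>

definition band_comb :: "nat \<Rightarrow> nat set \<Rightarrow> (nat \<Rightarrow> real) \<Rightarrow> real mat" where
  "band_comb p J c = mat p p (\<lambda>(k, l). \<Sum>j\<in>J. c j * diag_mat_A p j $$ (k, l))"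

lemma band_comb_carrier [simp]: "band_comb p J c \<in> carrier_mat p p"
  by (simp add: band_comb_def)

lemma band_comb_sym: "band_comb p J c \<in> sym_mats p"
  by (auto simp: sym_mats_def band_comb_def diag_mat_A_index band_simps(4))

lemma phi_band_comb:
  assumes "M \<in> carrier_mat p p"
  shows "phi (band_comb p J c) M = (\<Sum>j\<in>J. c j * phi (diag_mat_A p j) M)"
proof -
  have "phi (band_comb p J c) M = (\<Sum>k<p. \<Sum>l<p. \<Sum>j\<in>J. c j * (diag_mat_A p j $$ (k, l) * M $$ (l, k)))"
    unfolding phi_eq_sum[OF band_comb_carrier assms]
    by (intro sum.cong refl) (simp add: band_comb_def sum_distrib_right mult.assoc)
  also have "\<dots> = (\<Sum>j\<in>J. \<Sum>k<p. \<Sum>l<p. c j * (diag_mat_A p j $$ (k, l) * M $$ (l, k)))"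
    by (simp add: sum.swap[of _ J])
  also have "\<dots> = (\<Sum>j\<in>J. c j * phi (diag_mat_A p j) M)"
    unfolding phi_eq_sum[OF diag_mat_A_carrier assms] by (simp add: sum_distrib_left)
  finally show ?thesis .
qed

lemma band_comb_abs_le:
  assumes J: "J \<subseteq> {1..S}" "S < p" and kl: "k < p" "l < p"
  shows "\<bar>band_comb p J c $$ (k, l)\<bar> \<le> (\<Sum>j\<in>J. \<bar>c j\<bar> * \<bar>diag_mat_A p j $$ (k, l)\<bar>)"
  using kl sum_abs[of "\<lambda>j. c j * diag_mat_A p j $$ (k, l)" J] by (simp add: band_comb_def abs_mult)

lemma band_comb_row_sums:
  assumes J: "J \<subseteq> {1..S}" "S < p" and c: "(\<Sum>j\<in>J. \<bar>c j\<bar>) \<le> 1"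
  shows "abs_row_sums_le p (band_comb p J c) (1 / (real p - real S))"
  unfolding abs_row_sums_le_def
proof (intro allI impI)
  fix k assume k: "k < p"
  have "(\<Sum>l<p. \<bar>band_comb p J c $$ (k, l)\<bar>) \<le> (\<Sum>l<p. \<Sum>j\<in>J. \<bar>c j\<bar> * \<bar>diag_mat_A p j $$ (k, l)\<bar>)"
    using k by (intro sum_mono band_comb_abs_le[OF J]) auto
  also have "\<dots> = (\<Sum>j\<in>J. \<bar>c j\<bar> * (\<Sum>l<p. \<bar>diag_mat_A p j $$ (k, l)\<bar>))"
    by (simp add: sum.swap[of _ J] sum_distrib_left)
  also have "\<dots> \<le> (\<Sum>j\<in>J. \<bar>c j\<bar> * (1 / (real p - real S)))"
    using J k by (intro sum_mono mult_left_mono diag_mat_A_row_sums) auto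
  also have "\<dots> = (\<Sum>j\<in>J. \<bar>c j\<bar>) * (1 / (real p - real S))" by (simp only: sum_distrib_right)
  also have "\<dots> \<le> 1 * (1 / (real p - real S))" using c J by (intro mult_right_mono) auto
  finally show "(\<Sum>l<p. \<bar>band_comb p J c $$ (k, l)\<bar>) \<le> 1 / (real p - real S)" by simp
qed

lemma band_comb_abs_sum:
  assumes J: "J \<subseteq> {1..S}" "S < p" and c: "(\<Sum>j\<in>J. \<bar>c j\<bar>) \<le> 1"
  shows "(\<Sum>k<p. \<Sum>l<p. \<bar>band_comb p J c $$ (k, l)\<bar>) \<le> 1"
proof -
  have "(\<Sum>k<p. \<Sum>l<p. \<bar>band_comb p J c $$ (k, l)\<bar>) \<le>
      (\<Sum>k<p. \<Sum>l<p. \<Sum>j\<in>J. \<bar>c j\<bar> * \<bar>diag_mat_A p j $$ (k, l)\<bar>)"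
    by (intro sum_mono band_comb_abs_le[OF J]) auto
  also have "\<dots> = (\<Sum>j\<in>J. \<bar>c j\<bar> * (\<Sum>k<p. \<Sum>l<p. \<bar>diag_mat_A p j $$ (k, l)\<bar>))"
    by (simp add: sum.swap[of _ J] sum_distrib_left)
  also have "\<dots> = (\<Sum>j\<in>J. \<bar>c j\<bar>)"
  proof (rule sum.cong[OF refl])
    fix j assume "j \<in> J"
    hence j: "1 \<le> j" "j < p" using J by auto
    have "(\<Sum>k<p. \<Sum>l<p. \<bar>diag_mat_A p j $$ (k, l)\<bar>) = (\<Sum>k<p. \<Sum>l<p. diag_mat_A p j $$ (k, l))"
      using j by (intro sum.cong refl) (simp add: diag_mat_A_index abs_divide band_simps(3))
    thus "\<bar>c j\<bar> * (\<Sum>k<p. \<Sum>l<p. \<bar>diag_mat_A p j $$ (k, l)\<bar>) = \<bar>c j\<bar>"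
      using sum_diag_mat_A[OF j] by simp
  qed
  finally show ?thesis using c by simp
qed

section \<open>Bounds for the trace of the square of \<open>A * M\<close>\<close>

lemma mult_abs_index_le:
  assumes X: "X \<in> carrier_mat p p" "abs_row_sums_le p X x" and Y: "Y \<in> carrier_mat p p"
    and y: "\<And>i j. i < p \<Longrightarrow> j < p \<Longrightarrow> \<bar>Y $$ (i, j)\<bar> \<le> y" "0 \<le> y" and ij: "i < p" "j < p"
  shows "\<bar>(X * Y) $$ (i, j)\<bar> \<le> x * y"
proof -
  have "(X * Y) $$ (i, j) = (\<Sum>k<p. X $$ (i, k) * Y $$ (k, j))"
    using X Y ij by (auto simp: scalar_prod_def lessThan_atLeast0)
  also have "\<bar>\<dots>\<bar> \<le> (\<Sum>k<p. \<bar>X $$ (i, k)\<bar> * y)"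
    using y ij by (intro order_trans[OF sum_abs] sum_mono) (auto simp: abs_mult intro!: mult_left_mono)
  also have "\<dots> = (\<Sum>k<p. \<bar>X $$ (i, k)\<bar>) * y" by (simp add: sum_distrib_right)
  also have "\<dots> \<le> x * y"
    using X(2) ij y(2) by (intro mult_right_mono) (auto simp: abs_row_sums_le_def)
  finally show ?thesis .
qed

text \<open>The entries of \<open>A * M\<close> are at most \<open>a\<close>, so those of
  \<open>M * (A * M)\<close> are at most \<open>b * a\<close>; pairing them with \<open>A\<close>,
  whose absolute entries sum to at most 1, gives the bound.\<close>

lemma trace_square_le:
  assumes A: "A \<in> carrier_mat p p" "abs_row_sums_le p A a" "(\<Sum>k<p. \<Sum>l<p. \<bar>A $$ (k, l)\<bar>) \<le> 1" "0 \<le> a"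
    and M: "M \<in> carrier_mat p p" "abs_row_sums_le p M b" "0 \<le> b"
      "\<And>i j. i < p \<Longrightarrow> j < p \<Longrightarrow> \<bar>M $$ (i, j)\<bar> \<le> 1"
  shows "mat_trace (A * M * (A * M)) \<le> a * b"
proof -
  have AM: "A * M \<in> carrier_mat p p" and MAM: "M * (A * M) \<in> carrier_mat p p" using A M by auto
  have e1: "\<bar>(A * M) $$ (i, j)\<bar> \<le> a" if "i < p" "j < p" for i j
    using mult_abs_index_le[OF A(1,2) M(1,4) _ that] by simp
  have e2: "\<bar>(M * (A * M)) $$ (i, j)\<bar> \<le> b * a" if "i < p" "j < p" for i j
    using mult_abs_index_le[OF M(1,2) AM e1 A(4) that] .
  have "mat_trace (A * M * (A * M)) = phi A (M * (A * M))"
    unfolding phi_def assoc_mult_mat[OF A(1) M(1) AM] ..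
  also have "\<dots> = (\<Sum>k<p. \<Sum>l<p. A $$ (k, l) * (M * (A * M)) $$ (l, k))"
    by (rule phi_eq_sum[OF A(1) MAM])
  also have "\<dots> \<le> (\<Sum>k<p. \<Sum>l<p. \<bar>A $$ (k, l)\<bar> * (b * a))"
  proof (intro sum_mono)
    fix k l assume kl: "k \<in> {..<p}" "l \<in> {..<p}"
    have "A $$ (k, l) * (M * (A * M)) $$ (l, k) \<le> \<bar>A $$ (k, l)\<bar> * \<bar>(M * (A * M)) $$ (l, k)\<bar>"
      unfolding abs_mult[symmetric] by simp
    also have "\<dots> \<le> \<bar>A $$ (k, l)\<bar> * (b * a)" using kl by (intro mult_left_mono e2) auto
    finally show "A $$ (k, l) * (M * (A * M)) $$ (l, k) \<le> \<bar>A $$ (k, l)\<bar> * (b * a)" .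
  qed
  also have "\<dots> = (\<Sum>k<p. \<Sum>l<p. \<bar>A $$ (k, l)\<bar>) * (b * a)" by (simp only: sum_distrib_right)
  also have "\<dots> \<le> 1 * (b * a)" using A(3,4) M(3) by (intro mult_right_mono) auto
  finally show ?thesis by (simp add: mult.commute)
qed

text \<open>For a single band the square is computed explicitly: \<open>A * M\<close> is
  \<open>e / q\<close> times the band plus \<open>r\<close> times its square \<open>B2\<close>. The
  cross term vanishes and the rest is counted. The case \<open>r = 0\<close> is the identity
  covariance.\<close>

lemma trace_square_single_band_le:
  assumes j: "1 \<le> j" "j < p" and e: "e\<^sup>2 = 1"
    and A: "A \<in> carrier_mat p p" "\<And>k l. k < p \<Longrightarrow> l < p \<Longrightarrow> A $$ (k, l) = e * diag_mat_A p j $$ (k, l)"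
    and M: "M \<in> carrier_mat p p" "\<And>k l. k < p \<Longrightarrow> l < p \<Longrightarrow> M $$ (k, l) = (if k = l then 1 else 0) + r * band j k l"
  shows "mat_trace (A * M * (A * M)) \<le> (1 + 4 * r\<^sup>2) / (2 * (real p - real j))"
proof -
  define q where "q = 2 * (real p - real j)"
  have q: "0 < q" using j by (simp add: q_def)
  define B2 where "B2 k l = (\<Sum>m<p. band j k m * band j m l)" for k l
  have B2s: "B2 k l = B2 l k" for k l
    unfolding B2_def by (intro sum.cong refl) (simp add: band_simps(4)[of j k] band_simps(4)[of j _ l] mult.commute)
  have B2n: "0 \<le> B2 k l" for k l unfolding B2_def by (intro sum_nonneg mult_nonneg_nonneg band_simps)
  have B2u: "B2 k l \<le> 2" for k l
  proof -
    have "B2 k l \<le> (\<Sum>m<p. band j k m)"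
      unfolding B2_def by (intro sum_mono mult_left_le band_simps)
    thus ?thesis using sum_band_row_le[OF j(1), of k p] by simp
  qed
  \<comment> \<open>A nonzero entry of \<open>B2\<close> has index distance 0 or
    \<open>2 * j\<close>, never \<open>j\<close>, so the supports are disjoint.\<close>
  have B2b: "band j k l * B2 k l = 0" for k l
    unfolding B2_def sum_distrib_left using j(1) by (intro sum.neutral) (auto simp: band_def)
  have B2sum: "(\<Sum>k<p. \<Sum>l<p. B2 k l) \<le> 2 * q"
  proof -
    have "(\<Sum>k<p. \<Sum>l<p. B2 k l) = (\<Sum>k<p. \<Sum>m<p. band j k m * (\<Sum>l<p. band j m l))"
      unfolding B2_def sum_distrib_left by (intro sum.cong refl sum.swap)
    also have "\<dots> \<le> (\<Sum>k<p. \<Sum>m<p. band j k m * 2)"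
      by (intro sum_mono mult_left_mono sum_band_row_le j band_simps)
    also have "\<dots> = 2 * q"
      unfolding sum_distrib_right[symmetric] sum_band[OF j] q_def by simp
    finally show ?thesis .
  qed
  have AM: "(A * M) $$ (k, l) = e / q * (band j k l + r * B2 k l)" if kl: "k < p" "l < p" for k l
  proof -
    have "(A * M) $$ (k, l) = (\<Sum>m<p. A $$ (k, m) * M $$ (m, l))"
      using A M kl by (auto simp: scalar_prod_def lessThan_atLeast0)
    also have "\<dots> = (\<Sum>m<p. e / q * (band j k m * (if m = l then 1 else 0)) + e / q * r * (band j k m * band j m l))"
    proof (rule sum.cong[OF refl])
      fix m assume "m \<in> {..<p}"
      hence "A $$ (k, m) = e * (band j k m / q)" "M $$ (m, l) = (if m = l then 1 else 0) + r * band j m l"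
        using kl by (auto simp: A(2) M(2) diag_mat_A_index q_def)
      thus "A $$ (k, m) * M $$ (m, l) =
          e / q * (band j k m * (if m = l then 1 else 0)) + e / q * r * (band j k m * band j m l)"
        by (simp only: ring_distribs times_divide_eq_left times_divide_eq_right mult_ac)
    qed
    also have "\<dots> = e / q * (\<Sum>m<p. band j k m * (if m = l then 1 else 0)) + e / q * r * B2 k l"
      by (simp only: sum.distrib sum_distrib_left B2_def)
    also have "(\<Sum>m<p. band j k m * (if m = l then 1 else 0)) = band j k l"
      using kl by (simp add: if_distrib[of "\<lambda>x. _ * x"] cong: if_cong)
    finally show ?thesis by (simp add: algebra_simps)
  qed
  have AMc: "A * M \<in> carrier_mat p p" using A M by simp
  have "mat_trace (A * M * (A * M)) = phi (A * M) (A * M)" by (simp add: phi_def)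
  also have "\<dots> = (\<Sum>k<p. \<Sum>l<p. (A * M) $$ (k, l) * (A * M) $$ (l, k))"
    by (rule phi_eq_sum[OF AMc AMc])
  also have "\<dots> = (\<Sum>k<p. \<Sum>l<p. (e / q)\<^sup>2 * (band j k l + r\<^sup>2 * (B2 k l)\<^sup>2))"
  proof (intro sum.cong refl)
    fix k l assume "k \<in> {..<p}" "l \<in> {..<p}"
    hence "(A * M) $$ (k, l) * (A * M) $$ (l, k) = (e / q)\<^sup>2 * (band j k l + r * B2 k l)\<^sup>2"
      by (simp add: AM B2s[of l k] band_simps(4)[of j l k] power2_eq_square)
    also have "(band j k l + r * B2 k l)\<^sup>2 = band j k l * band j k l + 2 * r * (band j k l * B2 k l) + r\<^sup>2 * (B2 k l)\<^sup>2"
      by (simp add: power2_eq_square algebra_simps)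
    finally show "(A * M) $$ (k, l) * (A * M) $$ (l, k) = (e / q)\<^sup>2 * (band j k l + r\<^sup>2 * (B2 k l)\<^sup>2)"
      by (simp only: B2b band_simps(5)) simp
  qed
  \<comment> \<open>Since \<open>B2\<close> lies between 0 and 2, its square is at most twice
    itself, and the total of \<open>B2\<close> is already known to be at most
    \<open>2 * q\<close>.\<close>
  also have "\<dots> \<le> (\<Sum>k<p. \<Sum>l<p. (e / q)\<^sup>2 * (band j k l + r\<^sup>2 * (2 * B2 k l)))"
    by (intro sum_mono mult_left_mono add_left_mono)
      (auto simp: power2_eq_square intro!: mult_right_mono B2u B2n)
  also have "\<dots> = (e / q)\<^sup>2 * ((\<Sum>k<p. \<Sum>l<p. band j k l) + r\<^sup>2 * (2 * (\<Sum>k<p. \<Sum>l<p. B2 k l)))"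
    by (simp only: sum.distrib sum_distrib_left distrib_left)
  also have "\<dots> \<le> (e / q)\<^sup>2 * (q + r\<^sup>2 * (2 * (2 * q)))"
    using B2sum sum_band[OF j] by (intro mult_left_mono add_mono) (auto simp: q_def)
  also have "\<dots> = (1 + 4 * r\<^sup>2) / q"
    using q e by (simp add: power_divide field_simps power2_eq_square)
  finally show ?thesis by (simp add: q_def)
qed

section \<open>The two error probabilities\<close>

lemma type_I_single:
  assumes n: "1 \<le> n" and i: "1 \<le> i" "i \<le> S" "S < p" and x: "0 \<le> x" and e: "\<bar>e\<bar> = 1"
    and d: "d = max (sqrt (4 * x / (real n * (real p - real S)))) (8 * x / (real n * (real p - real S)))"
  shows "measure (gauss_sample n p (1\<^sub>m p))
      {X \<in> space (gauss_sample n p (1\<^sub>m p)). d \<le> e * phi (diag_mat_A p i) (sample_cov n p X)} \<le> exp (- x)"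
proof -
  let ?A = "band_comb p {i} (\<lambda>_. e)" and ?a = "1 / (real p - real S)"
  have ip: "i < p" "{i} \<subseteq> {1..S}" "1 \<le> i" using i by auto
  have a: "0 < ?a" using i by simp
  have ph: "phi ?A M = e * phi (diag_mat_A p i) M" if "M \<in> carrier_mat p p" for M
    using phi_band_comb[OF that] by simp
  have p1: "phi ?A (1\<^sub>m p) = 0" by (simp add: ph phi_diag_mat_A_one[OF ip(3,1)])
  have rows: "abs_row_sums_le p ?A ?a" using ip i e by (intro band_comb_row_sums) auto
  have one: "abs_row_sums_le p (1\<^sub>m p) 1"
    unfolding abs_row_sums_le_def by (auto simp: if_distrib[of abs] cong: if_cong)
  \<comment> \<open>The band bound at \<open>r = 0\<close> supplies the factor 1/2 that
    \<open>gauss_sample_tail\<close> asks for.\<close>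
  have tr: "mat_trace (?A * 1\<^sub>m p * (?A * 1\<^sub>m p)) \<le> (1 + 4 * 0\<^sup>2) / (2 * (real p - real i))"
    using e ip by (intro trace_square_single_band_le[where e = e])
      (auto simp: band_comb_def abs_square_eq_1 power2_eq_1_iff)
  also have "\<dots> \<le> ?a * 1 / 2"
    using i by (simp add: frac_le)
  finally have V: "mat_trace (?A * 1\<^sub>m p * (?A * 1\<^sub>m p)) \<le> ?a * 1 / 2" .
  have "max (sqrt (4 * x * (?a * 1) / real n)) (8 * x * (?a * 1) / real n) \<le> d"
    unfolding d by (simp add: mult.commute)
  hence "measure (gauss_sample n p (1\<^sub>m p))
      {X \<in> space (gauss_sample n p (1\<^sub>m p)). d \<le> phi ?A (sample_cov n p X) - phi ?A (1\<^sub>m p)} \<le> exp (- x)"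
    by (intro gauss_sample_tail[where a = ?a and b = 1] one_mat_spd band_comb_sym n rows a one V x) auto
  thus ?thesis by (simp add: ph p1)
qed

text \<open>The price of a union bound over \<open>S\<close> indices: \<open>u\<close> drops to
  \<open>u - 1\<close> in the exponent.\<close>

lemma exp_mult_ln: "1 \<le> S \<Longrightarrow> real S * exp (- (u * ln (real S))) = exp (- (u - 1) * ln (real S))"
  by (simp add: left_diff_distrib exp_diff exp_minus divide_simps)

lemma t_MS_nonneg: "1 < u \<Longrightarrow> 1 \<le> S \<Longrightarrow> S < p \<Longrightarrow> 0 \<le> t_MS n p S u"
  unfolding t_MS_def by (intro mult_nonneg_nonneg) (auto simp: max_def not_le)

text \<open>Subtracting the identity changes nothing, because \<open>diag_mat_A p i\<close> has zero
  diagonal for \<open>i \<ge> 1\<close>.\<close>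

lemma test_MS_eq:
  assumes "S < p"
  shows "test_MS n p S u X =
    (if t_MS n p S u \<le> (\<Sum>i = 1..S. \<bar>phi (diag_mat_A p i) (sample_cov n p X)\<bar>) then 1 else 0)"
proof -
  have "(\<Sum>i = 1..S. \<bar>phi (diag_mat_A p i) (sample_cov n p X - 1\<^sub>m p)\<bar>) =
    (\<Sum>i = 1..S. \<bar>phi (diag_mat_A p i) (sample_cov n p X)\<bar>)"
    using assms by (intro sum.cong refl)
      (simp add: phi_minus[of _ p] phi_diag_mat_A_one)
  thus ?thesis by (simp add: test_MS_def)
qed

lemma type_I_error:
  assumes n: "1 \<le> n" and S: "1 \<le> S" "S < p" and u: "1 < u"
  shows "measure (gauss_sample n p (1\<^sub>m p)) {X \<in> space (gauss_sample n p (1\<^sub>m p)). test_MS n p S u X = 1}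
    \<le> 2 * exp (- (u - 1) * ln (real S))"
proof -
  let ?M = "gauss_sample n p (1\<^sub>m p)"
  interpret prob_space ?M by (rule prob_space_gauss_sample[OF one_mat_spd])
  define x where "x = u * ln (real S)"
  define d where "d = max (sqrt (4 * x / (real n * (real p - real S)))) (8 * x / (real n * (real p - real S)))"
  define E where "E e i = {X \<in> space ?M. d \<le> e * phi (diag_mat_A p i) (sample_cov n p X)}" for e i
  have x: "0 \<le> x" using u S by (simp add: x_def)
  have t: "t_MS n p S u = real S * d" by (simp add: t_MS_def d_def x_def mult.assoc)
  have E_sets [measurable]: "E e i \<in> sets ?M" for e i
    unfolding E_def using measurable_phi_sample_cov[OF diag_mat_A_carrier] by measurable
  have E_le: "measure ?M (E e i) \<le> exp (- x)" if "1 \<le> i" "i \<le> S" "\<bar>e\<bar> = 1" for e i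
    unfolding E_def using that by (intro type_I_single[OF n _ _ S(2) x _ d_def]) auto
  have "{X \<in> space ?M. test_MS n p S u X = 1} \<subseteq> (\<Union>i\<in>{1..S}. E 1 i \<union> E (- 1) i)"
  proof
    fix X assume "X \<in> {X \<in> space ?M. test_MS n p S u X = 1}"
    hence X: "X \<in> space ?M" and X1: "test_MS n p S u X = 1" by blast+
    have ge: "real S * d \<le> (\<Sum>i = 1..S. \<bar>phi (diag_mat_A p i) (sample_cov n p X)\<bar>)"
      using X1 unfolding test_MS_eq[OF S(2)] t by (metis zero_neq_one)
    \<comment> \<open>The threshold is \<open>S * d\<close>, so if every summand were below
      \<open>d\<close> the test would accept.\<close>
    have "\<exists>i\<in>{1..S}. d \<le> \<bar>phi (diag_mat_A p i) (sample_cov n p X)\<bar>"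
    proof (rule ccontr)
      assume "\<not> ?thesis"
      hence "(\<Sum>i = 1..S. \<bar>phi (diag_mat_A p i) (sample_cov n p X)\<bar>) < (\<Sum>i = 1..S. d)"
        using S by (intro sum_strict_mono) (auto simp: not_le)
      thus False using ge by simp
    qed
    thus "X \<in> (\<Union>i\<in>{1..S}. E 1 i \<union> E (- 1) i)"
      using X by (auto simp: E_def abs_real_def split: if_splits)
  qed
  hence "measure ?M {X \<in> space ?M. test_MS n p S u X = 1} \<le> measure ?M (\<Union>i\<in>{1..S}. E 1 i \<union> E (- 1) i)"
    by (intro finite_measure_mono) auto
  also have "\<dots> \<le> (\<Sum>i\<in>{1..S}. measure ?M (E 1 i \<union> E (- 1) i))"
    by (intro finite_measure_subadditive_finite) auto
  also have "\<dots> \<le> (\<Sum>i\<in>{1..S}. 2 * exp (- x))"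
  proof (rule sum_mono)
    fix i assume "i \<in> {1..S}"
    hence "measure ?M (E 1 i) \<le> exp (- x)" "measure ?M (E (- 1) i) \<le> exp (- x)"
      by (auto intro: E_le)
    thus "measure ?M (E 1 i \<union> E (- 1) i) \<le> 2 * exp (- x)"
      using measure_Un_le[of "E 1 i" ?M "E (- 1) i"] by simp
  qed
  also have "\<dots> = 2 * exp (- (u - 1) * ln (real S))"
    using exp_mult_ln[OF S(1), of u] by (simp add: x_def)
  finally show ?thesis .
qed

text \<open>The minus sign in the weights turns the shortfall of the signed average into an upper
  deviation, the kind controlled by the tail lemmas. The two cases differ in how well the trace of
  the square can be bounded.\<close>

lemma alternative_tail:
  assumes n: "1 \<le> n" and s: "1 \<le> s" "s \<le> S" "real S < real p / 2" and u: "1 < u"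
    and \<sigma>: "0 < \<sigma>"
    and ge: "\<sigma> \<ge> t_MS n p S u +
           max (sqrt (4 * (u - 1) * (2 * real s + 1) * ln (real S) / (real n * (real p - real S))))
               (8 * (u - 1) * (2 * real s + 1) * ln (real S) / (real n * (real p - real S)))"
    and J: "J \<subseteq> {1..S}" "card J = s" "finite J"
    and J_ge: "\<And>j. j \<in> J \<Longrightarrow> \<sigma> \<le> \<bar>toep_coeff M j\<bar>"
    and J_0: "\<And>j. 1 \<le> j \<Longrightarrow> j < p \<Longrightarrow> j \<notin> J \<Longrightarrow> toep_coeff M j = 0"
    and M: "M \<in> spd_mats p" "M \<in> toeplitz_mats p" "toep_coeff M 0 = 1"
  defines "A \<equiv> band_comb p J (\<lambda>j. - sgn (toep_coeff M j) / real s)"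
  shows "measure (gauss_sample n p M)
      {X \<in> space (gauss_sample n p M). \<sigma> - t_MS n p S u / real s \<le> phi A (sample_cov n p X) - phi A M}
    \<le> exp (- (u - 1) * ln (real S))"
proof -
  define x where "x = (u - 1) * ln (real S)"
  define a where "a = 1 / (real p - real S)"
  define b where "b = 2 * real s + 1"
  define t where "t = t_MS n p S u"
  define d where "d = \<sigma> - t / real s"
  define w where "w = max (sqrt (4 * x * (a * b) / real n)) (8 * x * (a * b) / real n)"
  have S: "1 \<le> S" "S < p" using s by auto
  have x: "0 \<le> x" using u S by (simp add: x_def)
  have a: "0 < a" using S by (simp add: a_def)
  have b: "0 < b" by (simp add: b_def)
  have t: "0 \<le> t" unfolding t_def by (rule t_MS_nonneg[OF u S])
  have wt: "t + w \<le> \<sigma>"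
  proof -
    have e: "c * (u - 1) * (2 * real s + 1) * ln (real S) / (real n * (real p - real S)) =
        c * x * (a * b) / real n" for c
      unfolding x_def a_def b_def
      by (simp only: times_divide_eq_left times_divide_eq_right mult_1_left divide_divide_eq_left mult_ac)
    show ?thesis using ge unfolding e t_def w_def .
  qed
  have Mc: "M \<in> carrier_mat p p" using spd_matsD(1)[OF M(1)] .
  have As: "A \<in> sym_mats p" and Ac: "A \<in> carrier_mat p p" unfolding A_def by (auto simp: band_comb_sym)
  have c1: "(\<Sum>j\<in>J. \<bar>- sgn (toep_coeff M j) / real s\<bar>) \<le> 1"
  proof -
    have "(\<Sum>j\<in>J. \<bar>- sgn (toep_coeff M j) / real s\<bar>) \<le> (\<Sum>j\<in>J. 1 / real s)"
      by (intro sum_mono) (auto simp: abs_divide abs_sgn_eq divide_right_mono)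
    also have "\<dots> = 1" using J(2) s by simp
    finally show ?thesis .
  qed
  have A_rows: "abs_row_sums_le p A a" unfolding A_def a_def by (rule band_comb_row_sums[OF J(1) S(2) c1])
  have A_sum: "(\<Sum>k<p. \<Sum>l<p. \<bar>A $$ (k, l)\<bar>) \<le> 1" unfolding A_def by (rule band_comb_abs_sum[OF J(1) S(2) c1])
  have M_rows: "abs_row_sums_le p M b"
    using sparse_toeplitz_row_sums[OF J(3,1) J_0 M] J(2) by (simp add: b_def)
  have M_le: "\<bar>M $$ (i, j)\<bar> \<le> 1" if "i < p" "j < p" for i j
    using toeplitz_spd_index[OF M(1,2) that] toep_coeff_abs_le_1[OF M, of "nat \<bar>int i - int j\<bar>"] that by auto
  have "J \<noteq> {}" using J(2) s by auto
  then obtain j where j: "j \<in> J" by blast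
  \<comment> \<open>Here \<open>S < p / 2\<close> enters: position \<open>2 * j\<close> still lies
    inside the matrix.\<close>
  have jp: "1 \<le> j" "j \<le> S" "j < p" "2 * j < p" using j J(1) S s by auto
  have \<sigma>1: "\<sigma> \<le> 1" using J_ge[OF j] toep_coeff_abs_le_1[OF M jp(3)] by simp
  have "measure (gauss_sample n p M)
      {X \<in> space (gauss_sample n p M). d \<le> phi A (sample_cov n p X) - phi A M} \<le> exp (- x)"
  proof (cases "s = 1")
    case True
    then have Jj: "J = {j}" using J(2) j by (metis card_1_singletonE singletonD)
    define e where "e = - sgn (toep_coeff M j)"
    \<comment> \<open>Positivity of \<open>\<sigma>\<close> keeps the coefficient away from 0, so
      its sign is 1 or -1.\<close>
    have e: "e\<^sup>2 = 1" using J_ge[OF j] \<sigma> by (auto simp: e_def sgn_real_def)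
    have "mat_trace (A * M * (A * M)) \<le> (1 + 4 * (toep_coeff M j)\<^sup>2) / (2 * (real p - real j))"
    proof (rule trace_square_single_band_le[OF jp(1,3) e Ac _ Mc])
      fix k l assume kl: "k < p" "l < p"
      show "A $$ (k, l) = e * diag_mat_A p j $$ (k, l)"
        using kl True by (simp add: A_def band_comb_def Jj e_def)
      show "M $$ (k, l) = (if k = l then 1 else 0) + toep_coeff M j * band j k l"
      proof (cases "k = l")
        case True thus ?thesis
          using toeplitz_spd_index[OF M(1,2) kl] M(3) jp(1) by (simp add: band_def)
      next
        case False
        thus ?thesis
          using toeplitz_spd_index[OF M(1,2) kl] J_0[of "nat \<bar>int k - int l\<bar>"] kl by (auto simp: band_def Jj)
      qed
    qed
    \<comment> \<open>As \<open>2 * j\<close> lies outside the support, the squared coefficient is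
      below 1/2; the numerator becomes 3, which is \<open>b\<close> for
      \<open>s = 1\<close>.\<close>
    also have "\<dots> \<le> (1 + 4 * (1 / 2)) / (2 * (real p - real S))"
    proof (rule frac_le)
      have "toep_coeff M (2 * j) = 0" using J_0[of "2 * j"] jp by (simp add: Jj)
      from toep_coeff_squared_less_half[OF M jp(1,4) this]
      show "1 + 4 * (toep_coeff M j)\<^sup>2 \<le> 1 + 4 * (1 / 2)" by simp
    qed (use jp S in auto)
    also have "\<dots> = a * b / 2" using S True by (simp add: a_def b_def)
    finally have V: "mat_trace (A * M * (A * M)) \<le> a * b / 2" .
    have "w \<le> d" using wt True by (simp add: d_def)
    thus ?thesis
      using gauss_sample_tail[OF M(1) As n A_rows a M_rows b V _ x] by (simp add: w_def)
  next
    case False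
    hence s2: "2 \<le> s" using s by simp
    have V: "mat_trace (A * M * (A * M)) \<le> a * b"
      using trace_square_le[OF Ac A_rows A_sum _ Mc M_rows _ M_le] a b by simp
    \<comment> \<open>The goal is \<open>2 * b * q\<^sup>2 \<le> d\<^sup>2\<close>. The term
      \<open>w\<close> contributes \<open>sqrt b * q\<close> to \<open>d\<close>, and the surplus
      \<open>t - t / s\<close> contributes \<open>(s - 1) * q\<close> because
      \<open>t \<ge> S * q \<ge> s * q\<close>.\<close>
    define q where "q = sqrt (4 * x * a / real n)"
    have q: "0 \<le> q" using x a by (simp add: q_def)
    have "q \<le> sqrt (4 * u * ln (real S) / (real n * (real p - real S)))"
    proof -
      have "4 * x * a / real n = 4 * (u - 1) * ln (real S) / (real n * (real p - real S))"
        by (simp add: x_def a_def mult.commute)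
      also have "\<dots> \<le> 4 * u * ln (real S) / (real n * (real p - real S))"
        using S by (intro divide_right_mono mult_right_mono) auto
      finally show ?thesis unfolding q_def by (rule real_sqrt_le_mono)
    qed
    hence "real S * q \<le> t"
      unfolding t_def t_MS_def by (intro mult_left_mono) auto
    hence "real s * q \<le> t" using s q by (meson mult_right_mono of_nat_mono order_trans)
    hence tq: "(real s - 1) * q \<le> t - t / real s"
    proof -
      assume h: "real s * q \<le> t"
      have "(real s - 1) * q = (1 - 1 / real s) * (real s * q)" using s2 by (simp add: field_simps)
      also have "\<dots> \<le> (1 - 1 / real s) * t" using h s2 by (intro mult_left_mono) auto
      finally show ?thesis by (simp add: algebra_simps)
    qed
    have "sqrt b * q \<le> w"
      unfolding w_def q_def real_sqrt_mult[symmetric] by (simp add: mult_ac)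
    have dq: "(sqrt b + (real s - 1)) * q \<le> d"
      using \<open>sqrt b * q \<le> w\<close> tq wt by (simp add: d_def algebra_simps)
    have sb: "2 \<le> sqrt b" using s2 by (intro real_le_rsqrt) (simp add: b_def)
    \<comment> \<open>Using \<open>sqrt b \<ge> 2\<close> in the cross term and
      \<open>b = 2 * s + 1\<close>, this reduces to \<open>s\<^sup>2 \<ge> 4\<close>.\<close>
    have "2 * b \<le> (sqrt b + (real s - 1))\<^sup>2"
    proof -
      have "4 * (real s - 1) \<le> 2 * sqrt b * (real s - 1)" using sb s2 by (intro mult_right_mono) auto
      moreover have "0 \<le> (real s - 2) * (real s + 2)" using s2 by simp
      moreover have "(sqrt b + (real s - 1))\<^sup>2 = b + 2 * sqrt b * (real s - 1) + (real s - 1)\<^sup>2"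
        using b by (simp add: power2_sum)
      ultimately show ?thesis by (simp add: b_def power2_eq_square algebra_simps)
    qed
    hence "2 * b * q\<^sup>2 \<le> ((sqrt b + (real s - 1)) * q)\<^sup>2"
      unfolding power_mult_distrib by (intro mult_right_mono) auto
    also have "\<dots> \<le> d\<^sup>2" using dq q s2 b by (intro power_mono mult_nonneg_nonneg add_nonneg_nonneg) auto
    finally have dd: "8 * x * (a * b) / real n \<le> d\<^sup>2" using x a by (simp add: q_def mult_ac)
    have "0 \<le> (sqrt b + (real s - 1)) * q" using q s2 b by (intro mult_nonneg_nonneg) auto
    hence d0: "0 \<le> d" using dq by simp
    have "0 \<le> t / real s" using t by simp
    \<comment> \<open>Correlations are at most 1, so \<open>\<sigma> \<le> 1\<close>; this keeps the
      deviation in the single-regime range.\<close>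
    hence d1: "d \<le> 1" using \<sigma>1 unfolding d_def by linarith
    show ?thesis by (rule gauss_sample_tail_small[OF M(1) As n A_rows a M_rows b V dd d0 d1])
  qed
  thus ?thesis unfolding d_def t_def x_def minus_mult_left .
qed

text \<open>Acceptance bounds the sum of all absolute statistics by \<open>t_MS\<close>, so the
  signed average over \<open>J\<close> is at most \<open>t_MS / s\<close>, whereas its mean is at
  least \<open>\<sigma>\<close>. Acceptance is thus contained in the event of
  \<open>alternative_tail\<close>.\<close>

lemma type_II_error:
  assumes n: "1 \<le> n" and s: "1 \<le> s" "s \<le> S" "real S < real p / 2" and u: "1 < u"
    and \<sigma>: "0 < \<sigma>"
    and ge: "\<sigma> \<ge> t_MS n p S u +
           max (sqrt (4 * (u - 1) * (2 * real s + 1) * ln (real S) / (real n * (real p - real S))))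
               (8 * (u - 1) * (2 * real s + 1) * ln (real S) / (real n * (real p - real S)))"
    and M: "M \<in> sparse_toeplitz_class p s S \<sigma>"
  shows "measure (gauss_sample n p M) {X \<in> space (gauss_sample n p M). test_MS n p S u X = 0}
    \<le> exp (- (u - 1) * ln (real S))"
proof -
  have S: "S < p" using s by auto
  obtain J where J: "J \<subseteq> {1..S}" "card J = s" "finite J"
    "\<And>j. j \<in> J \<Longrightarrow> \<sigma> \<le> \<bar>toep_coeff M j\<bar>"
    "\<And>j. 1 \<le> j \<Longrightarrow> j < p \<Longrightarrow> j \<notin> J \<Longrightarrow> toep_coeff M j = 0"
    and M': "M \<in> spd_mats p" "M \<in> toeplitz_mats p" "toep_coeff M 0 = 1"
    using sparse_toeplitz_classE[OF M S] by metis
  interpret prob_space "gauss_sample n p M" by (rule prob_space_gauss_sample[OF M'(1)])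
  let ?\<phi> = "\<lambda>i X. phi (diag_mat_A p i) (sample_cov n p X)"
  define A where "A = band_comb p J (\<lambda>j. - sgn (toep_coeff M j) / real s)"
  have Mc: "M \<in> carrier_mat p p" using spd_matsD(1)[OF M'(1)] .
  have phiM: "phi (diag_mat_A p j) M = toep_coeff M j" if "j \<in> J" for j
    using that J(1) S by (intro phi_diag_mat_A_toeplitz Mc) (auto simp: toeplitz_spd_index[OF M'(1,2)])
  have "phi A M = (\<Sum>j\<in>J. - \<bar>toep_coeff M j\<bar> / real s)"
    unfolding A_def phi_band_comb[OF Mc] by (intro sum.cong refl) (simp add: phiM abs_sgn mult.commute)
  also have "\<dots> \<le> (\<Sum>j\<in>J. - \<sigma> / real s)"
    using J(4) by (intro sum_mono divide_right_mono) auto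
  also have "\<dots> = - \<sigma>" using J(2) s by simp
  finally have pM: "phi A M \<le> - \<sigma>" .
  have Ac: "A \<in> carrier_mat p p" by (simp add: A_def)
  note [measurable] = measurable_phi_sample_cov[OF Ac, of n M]
  have "{X \<in> space (gauss_sample n p M). test_MS n p S u X = 0} \<subseteq>
    {X \<in> space (gauss_sample n p M). \<sigma> - t_MS n p S u / real s \<le> phi A (sample_cov n p X) - phi A M}"
  proof safe
    fix X assume "test_MS n p S u X = 0"
    hence lt: "(\<Sum>i = 1..S. \<bar>?\<phi> i X\<bar>) < t_MS n p S u"
      by (simp add: test_MS_eq[OF S] split: if_splits)
    have "- phi A (sample_cov n p X) = (\<Sum>j\<in>J. sgn (toep_coeff M j) * ?\<phi> j X) / real s"
      unfolding A_def phi_band_comb[OF sample_cov_carrier]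
      by (simp add: sum_divide_distrib sum_negf)
    also have "\<dots> \<le> (\<Sum>j\<in>J. \<bar>?\<phi> j X\<bar>) / real s"
      by (intro divide_right_mono sum_mono) (auto simp: sgn_real_def)
    also have "\<dots> \<le> (\<Sum>i = 1..S. \<bar>?\<phi> i X\<bar>) / real s"
      using J(1) by (intro divide_right_mono sum_mono2) auto
    also have "\<dots> \<le> t_MS n p S u / real s" using lt by (intro divide_right_mono) auto
    finally show "\<sigma> - t_MS n p S u / real s \<le> phi A (sample_cov n p X) - phi A M" using pM by simp
  qed
  hence "measure (gauss_sample n p M) {X \<in> space (gauss_sample n p M). test_MS n p S u X = 0} \<le>
    measure (gauss_sample n p M)
     {X \<in> space (gauss_sample n p M). \<sigma> - t_MS n p S u / real s \<le> phi A (sample_cov n p X) - phi A M}"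
    by (intro finite_measure_mono) measurable
  also have "\<dots> \<le> exp (- (u - 1) * ln (real S))"
    unfolding A_def by (rule alternative_tail[OF n s u \<sigma> ge J M'])
  finally show ?thesis .
qed

theorem theorem3p2:
  fixes n p s S :: nat and u \<sigma> :: real
  assumes "n \<ge> 1"
    and "1 \<le> s" and "s \<le> S" and "real S < real p / 2"
    and "u > 1" and "\<sigma> > 0"
    and "\<sigma> \<ge> t_MS n p S u +
           max (sqrt (4 * (u - 1) * (2 * real s + 1) * ln (real S) / (real n * (real p - real S))))
               (8 * (u - 1) * (2 * real s + 1) * ln (real S) / (real n * (real p - real S)))"
  shows "testing_risk n p (test_MS n p S u) (sparse_toeplitz_class p s S \<sigma>)
           \<le> 4 * exp (- (u - 1) * ln (real S))"
proof -
  have S: "1 \<le> S" "S < p" using assms by auto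
  let ?e = "exp (- (u - 1) * ln (real S))" and ?G = "sparse_toeplitz_class p s S \<sigma>"
  \<comment> \<open>The error bound is uniform over the class and so passes to the supremum; for an
    empty class only positivity of the exponential is needed.\<close>
  have "(if ?G = {} then 0 else SUP M\<in>?G. measure (gauss_sample n p M)
      {X \<in> space (gauss_sample n p M). test_MS n p S u X = 0}) \<le> ?e"
    using type_II_error[OF assms] by (auto intro!: cSUP_least)
  \<comment> \<open>The two errors contribute \<open>2 * ?e\<close> and \<open>?e\<close>, and
    \<open>?e\<close> is positive.\<close>
  thus ?thesis
    using type_I_error[OF assms(1) S assms(5)] exp_gt_zero[of "- (u - 1) * ln (real S)"]
    unfolding testing_risk_def by linarith
qed

end
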